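(* Let $p>2$ and let $g\in C^1([0,\infty))$ satisfy: $(g_1)$ $\lim_{s\to 0^+} g(s)/s^{p-1}$ exists and belongs to $[0,1)$; $(g_2)$ $\liminf_{s\to\infty} g(s)/s^{p-1}>1$; $(g_3)$ there exists a constant $u_0>0$ such that $g(u_0)=u_0^{p-1}$ and $g'(u_0)>(p-1)u_0^{p-2}$. Then the problem $$-\Delta_p u+u^{p-1}=g(u)\ \text{in } B,\qquad u>0\ \text{in } B,\qquad \partial_\nu u=0\ \text{on }\partial B$$ admits a positive, nonconstant, radial, radially nondecreasing weak solution $u\in W^{1,p}(B)$. Moreover, if $u_{0,1},\dots,u_{0,n}$ are $n$ distinct positive constants each satisfying the property in $(g_3)$ (i.e. $g(u_{0,i})=u_{0,i}^{p-1}$ and $g'(u_{0,i})>(p-1)u_{0,i}^{p-2}$), then the problem admits $n$ distinct positive, nonconstant, radial, radially nondecreasing weak solutions.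
   Context: $B$ is the open unit ball of $\mathbb R^N$, $N\ge1$, $\nu$ the outer unit normal on $\partial B$, and $\Delta_p u=\mathrm{div}(|\nabla u|^{p-2}\nabla u)$. A weak solution is $u\in W^{1,p}(B)$ with $u>0$ such that $\int_B(|\nabla u|^{p-2}\nabla u\cdot\nabla\varphi+u^{p-1}\varphi)\,dx=\int_B g(u)\varphi\,dx$ for all $\varphi\in W^{1,p}(B)$ (the Neumann condition being encoded in the weak formulation). No growth restriction is imposed on $g$ at infinity (it may be Sobolev-supercritical). *)

theory Defs
  imports "HOL-Analysis.Analysis"
begin

definition c1_test :: "'a::euclidean_space set \<Rightarrow> ('a \<Rightarrow> real) \<Rightarrow> ('a \<Rightarrow> 'a) \<Rightarrow> bool" where
  "c1_test U phi Dphi \<longleftrightarrow>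
     (\<forall>x. (phi has_derivative (\<lambda>h. Dphi x \<bullet> h)) (at x)) \<and>
     continuous_on UNIV Dphi \<and>
     compact (closure {x. phi x \<noteq> 0}) \<and> closure {x. phi x \<noteq> 0} \<subseteq> U"

definition weak_gradient :: "'a::euclidean_space set \<Rightarrow> ('a \<Rightarrow> real) \<Rightarrow> ('a \<Rightarrow> 'a) \<Rightarrow> bool" where
  "weak_gradient U u G \<longleftrightarrow>
     u \<in> borel_measurable (lebesgue_on U) \<and> G \<in> borel_measurable (lebesgue_on U) \<and>
     (\<forall>K. compact K \<and> K \<subseteq> U \<longrightarrow>
        integrable (lebesgue_on K) u \<and> (\<forall>b\<in>Basis. integrable (lebesgue_on K) (\<lambda>x. G x \<bullet> b))) \<and>
     (\<forall>phi Dphi. c1_test U phi Dphi \<longrightarrow>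
        (\<forall>b\<in>Basis. integral\<^sup>L (lebesgue_on U) (\<lambda>x. u x * (Dphi x \<bullet> b))
                   = - integral\<^sup>L (lebesgue_on U) (\<lambda>x. (G x \<bullet> b) * phi x)))"

definition sobolev_grad :: "real \<Rightarrow> 'a::euclidean_space set \<Rightarrow> ('a \<Rightarrow> real) \<Rightarrow> ('a \<Rightarrow> 'a) \<Rightarrow> bool" where
  "sobolev_grad p U u G \<longleftrightarrow>
     weak_gradient U u G \<and>
     integrable (lebesgue_on U) (\<lambda>x. \<bar>u x\<bar> powr p) \<and>
     integrable (lebesgue_on U) (\<lambda>x. norm (G x) powr p)"

definition sobolev_W1p :: "real \<Rightarrow> 'a::euclidean_space set \<Rightarrow> ('a \<Rightarrow> real) \<Rightarrow> bool" where
  "sobolev_W1p p U u \<longleftrightarrow> (\<exists>G. sobolev_grad p U u G)"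

text \<open>Weak solution of  -Delta_p u + u^{p-1} = g(u), u > 0 in U, homogeneous Neumann
  condition (encoded in the weak formulation with test functions from W^{1,p}(U)).\<close>
definition neumann_weak_solution :: "real \<Rightarrow> (real \<Rightarrow> real) \<Rightarrow> 'a::euclidean_space set \<Rightarrow> ('a \<Rightarrow> real) \<Rightarrow> bool" where
  "neumann_weak_solution p g U u \<longleftrightarrow>
     (\<forall>x\<in>U. u x > 0) \<and>
     (\<exists>G. sobolev_grad p U u G \<and>
        (\<forall>phi Phi. sobolev_grad p U phi Phi \<longrightarrow>
           integrable (lebesgue_on U) (\<lambda>x. g (u x) * phi x) \<and>
           integral\<^sup>L (lebesgue_on U)
              (\<lambda>x. norm (G x) powr (p - 2) * (G x \<bullet> Phi x) + u x powr (p - 1) * phi x)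
           = integral\<^sup>L (lebesgue_on U) (\<lambda>x. g (u x) * phi x)))"

definition good_solution :: "real \<Rightarrow> (real \<Rightarrow> real) \<Rightarrow> ('a::euclidean_space \<Rightarrow> real) \<Rightarrow> bool" where
  "good_solution p g u \<longleftrightarrow>
     neumann_weak_solution p g (ball 0 1) u \<and>
     \<not> (\<exists>c. AE x in lebesgue_on (ball 0 1). u x = c) \<and>
     (\<exists>v. mono_on {0..<1} v \<and> (\<forall>x\<in>ball 0 1. u x = v (norm x)))"

end

theory Submission
  imports Defs "HOL-Complex_Analysis.Great_Picard"
begin

text \<open>
  With \<open>f s = g s - s powr (p - 1)\<close>, radial solutions correspond to the system
  \<open>u' = psi (w / r ^ (N - 1))\<close>, \<open>w' = - r ^ (N - 1) * f u\<close>, \<open>w 0 = 0\<close>, \<open>w 1 = 0\<close> with \<open>psi t = t powr (1 / (p - 1))\<close>;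
  nondecreasing means \<open>w \<ge> 0\<close>.  Since \<open>p > 2\<close>, \<open>psi\<close> is not Lipschitz at \<open>0\<close> and the initial value
  problem need not have a unique solution, so the shooting is done on an explicit Euler scheme, where the
  orbit depends continuously on the initial value \<open>d\<close>.  Let \<open>lo\<close> be the last zero of \<open>f\<close> below \<open>u0\<close>.
  For \<open>d\<close> close to \<open>lo\<close> the discrete \<open>w\<close> stays positive; for \<open>d\<close> close to \<open>u0\<close> it becomes negative,
  because \<open>f' u0 > 0\<close> and \<open>psi\<close> is steep at \<open>0\<close>.  In between, \<open>min w = 0\<close> for some \<open>d\<close>, and this minimum
  can only be attained at the last node.  The orbits are equi-Lipschitz (\<open>f\<close> is bounded below),
  and a limit as the mesh tends to \<open>0\<close> is the desired profile; it stays away from the constant \<open>u0\<close>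
  by the same steepness argument.  Solutions for different \<open>u0\<close> differ at the origin, where they take
  values in the disjoint intervals \<open>[lo, u0)\<close>.

  The profile yields a \<open>C\<^sup>1\<close> function on the ball.  The weak formulation against \<open>W\<^bsup>1,p\<^esup>\<close> functions follows
  by testing the weak gradient with the compactly supported fields obtained from \<open>w (norm x) x / norm x ^ N\<close>
  by cutting off small values of \<open>w\<close>.
\<close>

subsection \<open>The discrete shooting problem\<close>

lemma continuous_on_max_powr:
  fixes a :: real
  assumes "0 < a"
  shows "continuous_on UNIV (\<lambda>s. max 0 s powr a)"
  using assms by (intro continuous_on_powr') (auto intro!: continuous_intros)

text \<open>The least discrete flux over all nodes thereby becomes a continuous function of the
  initial value, as the intermediate value argument requires.\<close>

lemma continuous_on_Min_image:
  fixes F :: "'i \<Rightarrow> 'a::topological_space \<Rightarrow> real"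
  assumes "finite A" "A \<noteq> {}" "\<And>k. k \<in> A \<Longrightarrow> continuous_on S (F k)"
  shows "continuous_on S (\<lambda>x. Min ((\<lambda>k. F k x) ` A))"
  using assms
proof (induction A rule: finite_ne_induct)
  case (singleton k)
  then show ?case by simp
next
  case (insert k A)
  then have "continuous_on S (\<lambda>x. min (F k x) (Min ((\<lambda>k. F k x) ` A)))"
    by (intro continuous_on_min) auto
  then show ?case using insert.hyps by simp
qed

text \<open>Here \<open>m\<close> stands for \<open>N - 1\<close>, \<open>\<alpha>\<close> for
  \<open>1 / (p - 1)\<close>, and \<open>f\<close> for a continuous extension of
  \<open>g s - s powr (p - 1)\<close> to the line. \<open>f_slope\<close> is what
  \<open>f' u0 > 0\<close> gives near \<open>u0\<close>, with both signs of \<open>s - u0\<close>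
  covered at once; \<open>f_lower\<close> bounds the slopes of all orbits; \<open>f_hom\<close>
  keeps the initial values away from 0 in case \<open>lo = 0\<close>.\<close>

locale euler_shooting =
  fixes f :: "real \<Rightarrow> real" and \<alpha> :: real and m :: nat and lo u0 C :: real
  assumes alpha: "0 < \<alpha>" "\<alpha> < 1"
    and f_cont: "continuous_on UNIV f"
    and lo: "0 \<le> lo" "lo < u0" "f lo = 0" "f u0 = 0"
    and f_neg: "\<And>s. lo < s \<Longrightarrow> s < u0 \<Longrightarrow> f s < 0"
    and f_lower: "\<And>s. - C \<le> f s" and C_pos: "0 < C"
    and f_slope: "\<exists>a>0. \<exists>\<delta>>0. \<forall>s. \<bar>s - u0\<bar> \<le> \<delta> \<longrightarrow> a * (s - u0)\<^sup>2 \<le> f s * (s - u0)"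
    and f_hom: "\<exists>K>0. \<forall>s\<in>{0..u0}. - f s \<le> K * s powr (1 / \<alpha>)"
begin

section \<open>Truncated power and Euler scheme\<close>

text \<open>The inverse of \<open>t powr (p - 1)\<close> on the half-line, set to 0 for negative
  \<open>t\<close>. With this truncation an orbit is defined, nondecreasing and continuous in
  \<open>d\<close> even when its flux becomes negative, which the shooting argument needs.\<close>

definition psi :: "real \<Rightarrow> real" where
  "psi t = max 0 t powr \<alpha>"

lemma psi_nonneg: "0 \<le> psi t"
  by (simp add: psi_def)

lemma psi_pos: "0 < t \<Longrightarrow> 0 < psi t"
  by (simp add: psi_def)

lemma psi_zero [simp]: "psi 0 = 0"
  by (simp add: psi_def)

lemma psi_mono: "s \<le> t \<Longrightarrow> psi s \<le> psi t"
  using alpha by (auto simp: psi_def intro!: powr_mono2)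

lemma continuous_on_psi: "continuous_on UNIV psi"
  unfolding psi_def [abs_def] using alpha by (intro continuous_on_max_powr)

text \<open>The flux is advanced first, with the weight at the right end of the cell, and
  \<open>u\<close> is then advanced with the new flux. Thus there is no division by 0 at the centre,
  and a vanishing flux at a node leaves \<open>u\<close> unchanged in the step that arrives
  there.\<close>

primrec euler :: "nat \<Rightarrow> real \<Rightarrow> nat \<Rightarrow> real \<times> real" where
  "euler n d 0 = (d, 0)"
| "euler n d (Suc k) =
    (let w = snd (euler n d k) - (1 / n) * (Suc k / n) ^ m * f (fst (euler n d k))
     in (fst (euler n d k) + (1 / n) * psi (w / (Suc k / n) ^ m), w))"

definition eu :: "nat \<Rightarrow> real \<Rightarrow> nat \<Rightarrow> real" where
  "eu n d k = fst (euler n d k)"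

definition ew :: "nat \<Rightarrow> real \<Rightarrow> nat \<Rightarrow> real" where
  "ew n d k = snd (euler n d k)"

lemma eu_0 [simp]: "eu n d 0 = d" and ew_0 [simp]: "ew n d 0 = 0"
  by (simp_all add: eu_def ew_def)

lemma ew_Suc: "ew n d (Suc k) = ew n d k - (1 / n) * (Suc k / n) ^ m * f (eu n d k)"
  by (simp add: eu_def ew_def Let_def)

lemma eu_Suc: "eu n d (Suc k) = eu n d k + (1 / n) * psi (ew n d (Suc k) / (Suc k / n) ^ m)"
  by (simp add: eu_def ew_def Let_def)

lemma eu_mono: "k \<le> l \<Longrightarrow> eu n d k \<le> eu n d l"
  by (rule lift_Suc_mono_le[of "eu n d"]) (auto simp: eu_Suc psi_nonneg)

lemma eu_ge: "d \<le> eu n d k"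
  using eu_mono[of 0 k n d] by simp

lemma continuous_on_eu_ew:
  "continuous_on UNIV (\<lambda>d. eu n d k) \<and> continuous_on UNIV (\<lambda>d. ew n d k)"
proof (induction k)
  case 0
  then show ?case by simp
next
  case (Suc k)
  have w: "continuous_on UNIV (\<lambda>d. ew n d (Suc k))"
    unfolding ew_Suc using Suc
    by (intro continuous_intros continuous_on_compose2[OF f_cont]) auto
  moreover have "continuous_on UNIV (\<lambda>d. ew n d (Suc k) / (Suc k / n) ^ m)"
    using w unfolding divide_inverse by (intro continuous_on_mult continuous_on_const)
  ultimately show ?case
    unfolding eu_Suc using Suc
    by (intro conjI continuous_on_add continuous_on_mult continuous_on_const
        continuous_on_compose2[OF continuous_on_psi]) auto
qed

lemma ew_eq_sum: "ew n d k = (\<Sum>j<k. (1 / n) * (- ((Suc j / n) ^ m * f (eu n d j))))"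
  by (induction k) (auto simp: ew_Suc)

lemma ew_diff: "k \<le> l \<Longrightarrow> ew n d l - ew n d k = (1 / n) * (\<Sum>j=k..<l. - ((Suc j / n) ^ m * f (eu n d j)))"
  by (induction rule: dec_induct) (auto simp: ew_Suc algebra_simps)

lemma eu_diff: "k \<le> l \<Longrightarrow> eu n d l - eu n d k = (1 / n) * (\<Sum>j=k..<l. psi (ew n d (Suc j) / (Suc j / n) ^ m))"
  by (induction rule: dec_induct) (auto simp: eu_Suc algebra_simps)

lemma euler_stationary:
  assumes "f c = 0"
  shows "eu n c k = c \<and> ew n c k = 0"
  using assms by (induction k) (auto simp: ew_Suc eu_Suc)

section \<open>Estimates along discrete orbits\<close>

text \<open>Each of the \<open>k\<close> summands carries a weight of at most
  \<open>(k / n) ^ m\<close>. This discrete form of \<open>W r \<le> C * r * r ^ m\<close> makes the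
  quotient by the weight of order \<open>k / n\<close>, hence harmless at the centre.\<close>

lemma ew_le:
  assumes n: "0 < n" and b: "0 \<le> b" "\<And>j. j < k \<Longrightarrow> - f (eu n d j) \<le> b"
  shows "ew n d k \<le> b * (k / n) * (k / n) ^ m"
proof -
  have "ew n d k = (1 / n) * (\<Sum>j<k. - ((Suc j / n) ^ m * f (eu n d j)))"
    using ew_eq_sum[of n d k] by (simp add: sum_distrib_left)
  also have "\<dots> \<le> (1 / n) * (\<Sum>j<k. (k / n) ^ m * b)"
  proof (intro mult_left_mono sum_mono)
    fix j assume j: "j \<in> {..<k}"
    have "- ((Suc j / n) ^ m * f (eu n d j)) = (Suc j / n) ^ m * (- f (eu n d j))"
      by simp
    also have "\<dots> \<le> (Suc j / n) ^ m * b"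
      using b j by (intro mult_left_mono) auto
    also have "\<dots> \<le> (k / n) ^ m * b"
      using b j by (intro mult_right_mono power_mono divide_right_mono) auto
    finally show "- ((Suc j / n) ^ m * f (eu n d j)) \<le> (k / n) ^ m * b" .
  qed simp
  also have "\<dots> = b * (k / n) * (k / n) ^ m" by simp
  finally show ?thesis .
qed

lemma slope_le:
  assumes n: "0 < n" and k: "0 < k" "k \<le> n" and b: "0 \<le> b" "\<And>j. j < k \<Longrightarrow> - f (eu n d j) \<le> b"
  shows "psi (ew n d k / (k / n) ^ m) \<le> psi b"
proof (rule psi_mono)
  have "ew n d k \<le> b * (k / n) * (k / n) ^ m" by (rule ew_le[OF n b])
  then have "ew n d k / (k / n) ^ m \<le> b * (k / n)"
    using n k by (simp add: divide_le_eq)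
  also have "\<dots> \<le> b * 1" using n k b by (intro mult_left_mono) auto
  finally show "ew n d k / (k / n) ^ m \<le> b" by simp
qed

text \<open>The constant depends neither on the mesh nor on the initial value; this is the
  equicontinuity for the passage to the limit.\<close>

lemma eu_lipschitz:
  assumes n: "0 < n" and kl: "k \<le> l" "l \<le> n"
  shows "eu n d l - eu n d k \<le> psi C * (l / n - k / n)"
proof -
  have "eu n d l - eu n d k \<le> (1 / n) * (\<Sum>j=k..<l. psi C)"
    unfolding eu_diff[OF kl(1)]
  proof (intro mult_left_mono sum_mono)
    fix j assume "j \<in> {k..<l}"
    then show "psi (ew n d (Suc j) / (Suc j / n) ^ m) \<le> psi C"
      using slope_le[OF n, of "Suc j" C d] kl C_pos f_lower by (auto simp: minus_le_iff)
  qed simp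
  also have "\<dots> = psi C * (l / n - k / n)"
    using kl by (simp add: of_nat_diff diff_divide_distrib left_diff_distrib right_diff_distrib mult.commute)
  finally show ?thesis .
qed

text \<open>The weight at nodes up to \<open>n\<close> is at most 1, so dividing by it can only
  enlarge a nonnegative flux.\<close>

lemma eu_increment_ge:
  assumes n: "0 < n" and kl: "k \<le> l" "l \<le> n" and b: "0 \<le> b" "\<And>j. k < j \<Longrightarrow> j \<le> l \<Longrightarrow> b \<le> ew n d j"
  shows "(l - k) / n * psi b \<le> eu n d l - eu n d k"
proof -
  have "(real l - real k) / n * psi b = (1 / n) * (\<Sum>j=k..<l. psi b)"
    using kl by (simp add: of_nat_diff)
  also have "\<dots> \<le> eu n d l - eu n d k"
    unfolding eu_diff[OF kl(1)]
  proof (intro mult_left_mono sum_mono psi_mono)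
    fix j assume j: "j \<in> {k..<l}"
    have "b \<le> ew n d (Suc j)" using b j by auto
    also have "\<dots> \<le> ew n d (Suc j) / (Suc j / n) ^ m"
    proof -
      have 1: "0 \<le> ew n d (Suc j)" using b(1) b(2)[of "Suc j"] j by simp
      have 2: "(Suc j / n) ^ m \<le> 1" using j kl n by (intro power_le_one) auto
      have 3: "0 < (Suc j / n) ^ m" using n by auto
      show ?thesis using 1 2 3 by (simp add: le_divide_eq mult_left_le)
    qed
    finally show "b \<le> ew n d (Suc j) / (Suc j / n) ^ m" .
  qed simp
  finally show ?thesis .
qed

text \<open>From the node \<open>q\<close> on, that is for radii of at least 1/5, the weight is
  bounded below by \<open>(1 / 5) ^ m\<close>. The sign \<open>\<sigma>\<close> serves both regimes:
  growth of the flux where \<open>f\<close> is negative, decay where it is positive. Meshes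
  \<open>5 * q\<close> allow a division of the unit interval into fifths.\<close>

lemma ew_increment_ge:
  assumes q: "0 < q" and kl: "q \<le> k" "k \<le> l" and b: "0 \<le> b" "\<And>j. k \<le> j \<Longrightarrow> j < l \<Longrightarrow> b \<le> \<sigma> * f (eu (5 * q) d j)"
    and \<sigma>: "\<sigma> = 1 \<or> \<sigma> = - 1"
  shows "(real l - real k) / real (5 * q) * (1 / 5) ^ m * b \<le> - \<sigma> * (ew (5 * q) d l - ew (5 * q) d k)"
proof -
  let ?n = "5 * q"
  have "(real l - real k) / real (5 * q) * (1 / 5) ^ m * b = (1 / ?n) * (\<Sum>j=k..<l. (1/5) ^ m * b)"
    using kl by (simp add: of_nat_diff)
  also have "\<dots> \<le> (1 / ?n) * (\<Sum>j=k..<l. (Suc j / ?n) ^ m * (\<sigma> * f (eu ?n d j)))"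
  proof (intro mult_left_mono sum_mono)
    fix j assume j: "j \<in> {k..<l}"
    have "1/5 \<le> Suc j / ?n" using j kl q by (simp add: field_simps)
    then show "(1/5) ^ m * b \<le> (Suc j / ?n) ^ m * (\<sigma> * f (eu ?n d j))"
      using b j by (intro mult_mono power_mono) auto
  qed simp
  also have "\<dots> = - \<sigma> * (ew ?n d l - ew ?n d k)"
    unfolding ew_diff[OF kl(2)] by (simp add: sum_distrib_left sum_negf mult.assoc mult.left_commute)
  finally show ?thesis by simp
qed


section \<open>Instability of the constant \<open>u0\<close>\<close>

text \<open>If the orbit is below \<open>u0\<close> up to radius 3/5, the gap \<open>y\<close> at
  2/5 builds up a flux of at least \<open>c * y\<close> on the second fifth, and this flux raises
  \<open>u\<close> on the third fifth by more than \<open>y\<close>, past \<open>u0\<close>.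
  Otherwise the excess \<open>y\<close> at 4/5 lowers the flux on the last fifth by at least
  \<open>c * y\<close>; the flux must therefore have been that large on the fourth fifth, where
  \<open>u\<close> then rises by more than \<open>y\<close> although it started at or above
  \<open>u0\<close>. The bound \<open>\<delta>\<close> is uniform in mesh and initial value.\<close>

lemma no_small_orbit:
  "\<exists>\<delta>>0. \<forall>q>0. \<forall>d<u0. \<not> (\<forall>k\<le>5 * q. 0 \<le> ew (5 * q) d k \<and> \<bar>eu (5 * q) d k - u0\<bar> \<le> \<delta>)"
proof -
  obtain a \<delta>0 where a: "0 < a" "0 < \<delta>0"
    "\<And>s. \<bar>s - u0\<bar> \<le> \<delta>0 \<Longrightarrow> a * (s - u0)\<^sup>2 \<le> f s * (s - u0)"
    using f_slope by auto
  \<comment> \<open>The factors are the length of one fifth, a lower bound for the weight on the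
    relevant radii, and the slope constant of \<open>f\<close> at \<open>u0\<close>.\<close>
  define c where "c = (1 / 5) * (1 / 5) ^ m * a"
  have c: "0 < c" using a by (simp add: c_def)
  \<comment> \<open>\<open>\<eta>\<close> solves
    \<open>\<eta> powr (1 - \<alpha>) = c powr \<alpha> / 10\<close>; being half of
    \<open>c powr \<alpha> / 5\<close>, this value leaves room for a strict inequality.\<close>
  define \<eta> where "\<eta> = (c powr \<alpha> / 10) powr (1 / (1 - \<alpha>))"
  have \<eta>: "0 < \<eta>" using c by (simp add: \<eta>_def)
  \<comment> \<open>As the exponent is less than 1, psi is steep at the origin.\<close>
  have steep: "y < 1 / 5 * psi (c * y)" if y: "0 < y" "y \<le> \<eta>" for y
  proof -
    have "y powr (1 - \<alpha>) \<le> \<eta> powr (1 - \<alpha>)" using y alpha by (intro powr_mono2) auto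
    also have "\<dots> = c powr \<alpha> / 10" using alpha c by (simp add: \<eta>_def powr_powr)
    also have "\<dots> < c powr \<alpha> / 5" using c by simp
    finally have "y powr (1 - \<alpha>) * y powr \<alpha> < c powr \<alpha> / 5 * y powr \<alpha>"
      using y by (intro mult_strict_right_mono) auto
    moreover have "y powr (1 - \<alpha>) * y powr \<alpha> = y" using y by (simp add: powr_add[symmetric])
    ultimately show ?thesis using y c by (simp add: psi_def powr_mult)
  qed
  have f_ge: "a * (s - u0) \<le> f s" if "u0 \<le> s" "s - u0 \<le> \<delta>0" for s
  proof (cases "s = u0")
    case False
    with a(3)[of s] that show ?thesis
      by (auto simp: power2_eq_square mult.assoc[symmetric] mult_le_cancel_right)
  qed (use lo in auto)
  have f_le: "a * (u0 - s) \<le> - f s" if "s \<le> u0" "u0 - s \<le> \<delta>0" for s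
  proof (cases "s = u0")
    case False
    have "a * (u0 - s) * (u0 - s) \<le> (- f s) * (u0 - s)"
      using a(3)[of s] that by (auto simp: power2_eq_square algebra_simps)
    with False that show ?thesis by (simp only: mult_le_cancel_right)
  qed (use lo in auto)
  define \<delta> where "\<delta> = min \<delta>0 \<eta>"
  have "False" if q: "0 < q" and d: "d < u0"
    and orb: "\<And>k. k \<le> 5 * q \<Longrightarrow> 0 \<le> ew (5 * q) d k \<and> \<bar>eu (5 * q) d k - u0\<bar> \<le> \<delta>" for q d
  proof -
    let ?u = "eu (5 * q) d" and ?w = "ew (5 * q) d"
    have w0: "0 \<le> ?w k" and uu: "?u k - u0 \<le> \<delta>0" "u0 - ?u k \<le> \<delta>0" "?u k - u0 \<le> \<eta>" "u0 - ?u k \<le> \<eta>"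
      if "k \<le> 5 * q" for k using orb[OF that] by (auto simp: \<delta>_def)
    show False
    proof (cases "?u (3 * q) < u0")
      case True
      define y where "y = u0 - ?u (2 * q)"
      have below: "?u j < u0" if "j \<le> 3 * q" for j
        using eu_mono[OF that, of "5*q" d] True by simp
      have y: "0 < y" "y \<le> \<eta>" using below[of "2 * q"] uu(4)[of "2 * q"] by (auto simp: y_def)
      have "(real (2 * q) - real q) / (5 * q) * (1 / 5) ^ m * (a * y) \<le> - (- 1) * (?w (2 * q) - ?w q)"
      proof (rule ew_increment_ge)
        show "0 \<le> a * y" using a y by simp
        fix j assume j: "q \<le> j" "j < 2 * q"
        have "a * y \<le> a * (u0 - ?u j)"
          using a j eu_mono[of j "2 * q" "5 * q" d] by (simp add: y_def)
        also have "\<dots> \<le> - f (?u j)"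
          using below[of j] uu(2)[of j] j by (intro f_le) auto
        finally show "a * y \<le> - 1 * f (?u j)" by simp
      qed (use q in auto)
      then have w2: "c * y \<le> ?w (2 * q)" using w0[of q] q by (simp add: c_def)
      have w_ge: "c * y \<le> ?w j" if "2 * q \<le> j" "j \<le> 3 * q" for j
      proof -
        have "(real j - real (2 * q)) / (5 * q) * (1 / 5) ^ m * 0 \<le> - (- 1) * (?w j - ?w (2 * q))"
        proof (rule ew_increment_ge)
          fix i assume i: "2 * q \<le> i" "i < j"
          have "0 \<le> a * (u0 - ?u i)" using below[of i] i that a by simp
          also have "\<dots> \<le> - f (?u i)" using below[of i] uu(2)[of i] i that by (intro f_le) auto
          finally show "0 \<le> - 1 * f (?u i)" by simp
        qed (use q that in auto)
        with w2 show ?thesis by simp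
      qed
      have "(real (3 * q) - real (2 * q)) / (5 * q) * psi (c * y) \<le> ?u (3 * q) - ?u (2 * q)"
        using eu_increment_ge[of "5 * q" "2 * q" "3 * q" "c * y" d] q c y w_ge by auto
      then have "1 / 5 * psi (c * y) \<le> ?u (3 * q) - ?u (2 * q)" using q by simp
      with steep[OF y] True show False by (simp add: y_def)
    next
      case False
      have above: "u0 \<le> ?u j" if "3 * q \<le> j" for j
        using eu_mono[OF that, of "5*q" d] False by simp
      \<comment> \<open>The node \<open>K\<close> is the first at which \<open>u0\<close> is
        reached. The step into it starts below \<open>u0\<close>, so its flux is positive; even if
        the orbit hits \<open>u0\<close> exactly, it lies strictly above one node later. This makes
        the excess at radius 4/5 positive.\<close>
      define K where "K = (LEAST k. u0 \<le> ?u k)"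
      have "u0 \<le> ?u (3 * q)" using False by simp
      then have K: "u0 \<le> ?u K" "K \<le> 3 * q"
        unfolding K_def by (rule LeastI, rule Least_le)
      have bK: "?u j < u0" if "j < K" for j
        using not_less_Least[of j "\<lambda>k. u0 \<le> ?u k"] that by (simp add: K_def)
      have "K \<noteq> 0" using K d by (cases "K = 0") auto
      then obtain k where k: "K = Suc k" by (cases K) auto
      have "0 < ?w K"
      proof -
        have "f (?u k) < 0"
        proof -
          have "a * (u0 - ?u k) \<le> - f (?u k)"
            using bK[of k] k K uu(2)[of k] by (intro f_le) auto
          moreover have "0 < a * (u0 - ?u k)" using bK[of k] k a by simp
          ultimately show ?thesis by simp
        qed
        then have "(1 / (5 * q)) * (Suc k / (5 * q)) ^ m * f (?u k) < 0"
          using q by (intro mult_pos_neg) auto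
        then show ?thesis using w0[of k] k K by (simp add: ew_Suc)
      qed
      have "u0 < ?u (Suc K)"
      proof (cases "?u K = u0")
        case True
        then have "?w (Suc K) = ?w K" using lo by (simp add: ew_Suc)
        then have "0 < psi (?w (Suc K) / (Suc K / real (5 * q)) ^ m)"
          using \<open>0 < ?w K\<close> q by (intro psi_pos) auto
        then have "?u K < ?u (Suc K)" using q by (simp add: eu_Suc)
        with True show ?thesis by simp
      next
        case False
        with K eu_mono[of K "Suc K" "5 * q" d] show ?thesis by simp
      qed
      also have "\<dots> \<le> ?u (4 * q)" using K q by (intro eu_mono) auto
      finally have pos: "u0 < ?u (4 * q)" .
      define y where "y = ?u (4 * q) - u0"
      have y: "0 < y" "y \<le> \<eta>" using pos uu(3)[of "4 * q"] by (auto simp: y_def)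
      have "(real (5 * q) - real (4 * q)) / (5 * q) * (1 / 5) ^ m * (a * y) \<le> - 1 * (?w (5 * q) - ?w (4 * q))"
      proof (rule ew_increment_ge)
        show "0 \<le> a * y" using a y by simp
        fix j assume j: "4 * q \<le> j" "j < 5 * q"
        have "a * y \<le> a * (?u j - u0)"
          using a j eu_mono[of "4 * q" j "5 * q" d] by (simp add: y_def)
        also have "\<dots> \<le> f (?u j)"
          using above[of j] uu(1)[of j] j by (intro f_ge) auto
        finally show "a * y \<le> 1 * f (?u j)" by simp
      qed (use q in auto)
      then have w4: "c * y \<le> ?w (4 * q)" using w0[of "5 * q"] q by (simp add: c_def)
      have w_ge: "c * y \<le> ?w j" if "3 * q \<le> j" "j \<le> 4 * q" for j
      proof -
        have "(real (4 * q) - real j) / (5 * q) * (1 / 5) ^ m * 0 \<le> - 1 * (?w (4 * q) - ?w j)"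
        proof (rule ew_increment_ge)
          fix i assume i: "j \<le> i" "i < 4 * q"
          have "0 \<le> a * (?u i - u0)" using above[of i] i that a by simp
          also have "\<dots> \<le> f (?u i)" using above[of i] uu(1)[of i] i that by (intro f_ge) auto
          finally show "0 \<le> 1 * f (?u i)" by simp
        qed (use q that in auto)
        with w4 show ?thesis by simp
      qed
      have "(real (4 * q) - real (3 * q)) / (5 * q) * psi (c * y) \<le> ?u (4 * q) - ?u (3 * q)"
        using eu_increment_ge[of "5 * q" "3 * q" "4 * q" "c * y" d] q c y w_ge by auto
      then have "1 / 5 * psi (c * y) \<le> ?u (4 * q) - ?u (3 * q)" using q by simp
      with steep[OF y] above[of "3 * q"] show False by (simp add: y_def)
    qed
  qed
  moreover have "0 < \<delta>" using a \<eta> by (simp add: \<delta>_def)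
  ultimately show ?thesis by blast
qed

text \<open>A zero of \<open>f\<close> is a stationary orbit, and orbits depend continuously on
  \<open>d\<close>; for a fixed mesh the finitely many nodes admit a common radius.\<close>

lemma eu_near:
  assumes "f c = 0" "0 < e"
  shows "\<exists>r>0. \<forall>d. \<bar>d - c\<bar> < r \<longrightarrow> (\<forall>k\<le>n. \<bar>eu n d k - c\<bar> < e)"
proof -
  have "\<forall>\<^sub>F d in nhds c. \<bar>eu n d k - c\<bar> < e" for k
  proof -
    have "isCont (\<lambda>d. eu n d k) c"
      using continuous_on_eu_ew[of n k] by (simp add: continuous_on_eq_continuous_at)
    then have "((\<lambda>d. eu n d k) \<longlongrightarrow> c) (nhds c)"
      using euler_stationary[OF assms(1), of n k] by (metis isCont_def tendsto_at_iff_tendsto_nhds)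
    then have "\<forall>\<^sub>F d in nhds c. dist (eu n d k) c < e" using assms(2) by (rule tendstoD)
    then show ?thesis by (simp add: dist_real_def)
  qed
  then have "\<forall>\<^sub>F d in nhds c. \<forall>k\<in>{..n}. \<bar>eu n d k - c\<bar> < e"
    by (intro eventually_ball_finite) auto
  then show ?thesis by (auto simp: eventually_nhds_metric dist_real_def)
qed

section \<open>Shooting with the least flux\<close>

text \<open>The intermediate value theorem is applied to the least flux. If this is 0 and first
  attained at an inner node \<open>j\<close>, then the flux dropped in the step to \<open>j\<close>,
  so \<open>f\<close> is positive at the node before; since the new flux is 0, \<open>u\<close> does
  not move, and the next step makes the flux negative.\<close>

lemma shooting_discrete:
  assumes q: "0 < q"
  shows "\<exists>d. lo < d \<and> d < u0 \<and> (\<forall>k\<le>5 * q. 0 \<le> ew (5 * q) d k) \<and> ew (5 * q) d (5 * q) = 0"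
proof -
  define n where "n = 5 * q"
  have n: "0 < n" using q by (simp add: n_def)
  \<comment> \<open>Node 0 is left out because the flux vanishes there for every
    \<open>d\<close>.\<close>
  define M where "M = (\<lambda>d. Min ((\<lambda>k. ew n d k) ` {1..n}))"
  have M_cont: "continuous_on UNIV M"
    unfolding M_def using n continuous_on_eu_ew[of n] by (intro continuous_on_Min_image) auto
  have M_le: "M d \<le> ew n d k" if "1 \<le> k" "k \<le> n" for d k
    unfolding M_def using that by (intro Min_le) auto
  have M_in: "\<exists>k\<in>{1..n}. M d = ew n d k" for d
  proof -
    have "M d \<in> (\<lambda>k. ew n d k) ` {1..n}" unfolding M_def using n by (intro Min_in) auto
    then show ?thesis by auto
  qed
  have step: "ew n d k < ew n d (Suc k)" if "f (eu n d k) < 0" for d k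
    using that n by (simp add: ew_Suc mult_pos_neg divide_neg_pos)
  have step': "ew n d (Suc k) \<ge> ew n d k" if "f (eu n d k) \<le> 0" for d k
    using that n by (simp add: ew_Suc mult_nonneg_nonpos divide_nonpos_pos)
  obtain d1 where d1: "lo < d1" "d1 < u0" "0 < M d1"
  proof -
    \<comment> \<open>The tolerance \<open>u0 - lo\<close> keeps the whole orbit inside the interval
      where \<open>f\<close> is negative.\<close>
    obtain r where r: "0 < r" "\<And>d k. \<bar>d - lo\<bar> < r \<Longrightarrow> k \<le> n \<Longrightarrow> \<bar>eu n d k - lo\<bar> < u0 - lo"
      using eu_near[of lo "u0 - lo" n] lo by auto
    define d where "d = lo + min (r / 2) ((u0 - lo) / 2)"
    have d: "lo < d" "d < u0" "\<bar>d - lo\<bar> < r" using r lo by (auto simp: d_def min_def field_simps)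
    have neg: "f (eu n d k) < 0" if "k \<le> n" for k
      using r(2)[OF d(3) that] eu_ge[of d n k] d by (intro f_neg) auto
    have "0 < ew n d (Suc k)" if "k < n" for k
      using that
    proof (induction k)
      case 0
      then show ?case using step[OF neg[of 0]] by simp
    next
      case (Suc k)
      then show ?case using step[OF neg[of "Suc k"]] by simp
    qed
    moreover obtain k where "k \<in> {1..n}" "M d = ew n d k" using M_in by blast
    ultimately have "0 < M d" by (cases k) auto
    with d that show ?thesis by blast
  qed
  obtain \<delta> where \<delta>: "0 < \<delta>"
    "\<And>d. d < u0 \<Longrightarrow> \<not> (\<forall>k\<le>n. 0 \<le> ew n d k \<and> \<bar>eu n d k - u0\<bar> \<le> \<delta>)"
    using no_small_orbit q unfolding n_def by blast
  obtain d2 where d2: "d1 < d2" "d2 < u0" "M d2 < 0"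
  proof -
    \<comment> \<open>An orbit within \<open>\<delta>\<close> of \<open>u0\<close> cannot have
      nonnegative flux at all nodes.\<close>
    obtain r where r: "0 < r" "\<And>d k. \<bar>d - u0\<bar> < r \<Longrightarrow> k \<le> n \<Longrightarrow> \<bar>eu n d k - u0\<bar> < \<delta>"
      using eu_near[of u0 \<delta> n] lo \<delta> by auto
    define d where "d = u0 - min (r / 2) ((u0 - d1) / 2)"
    have d: "d1 < d" "d < u0" "\<bar>d - u0\<bar> < r" using r d1 by (auto simp: d_def min_def field_simps)
    obtain k where k: "k \<le> n" "ew n d k < 0"
      using \<delta>(2)[OF d(2)] r(2)[OF d(3)] by (meson less_imp_le not_le)
    then have "1 \<le> k" by (cases k) auto
    with M_le[of k d] k have "M d < 0" by simp
    with d that show ?thesis by blast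
  qed
  obtain d where d: "d1 \<le> d" "d \<le> d2" "M d = 0"
    using IVT2'[of M d2 0 d1] d1 d2 M_cont by (auto intro: continuous_on_subset)
  have dl: "lo < d" "d < u0" using d d1 d2 by auto
  have nonneg: "0 \<le> ew n d k" if "k \<le> n" for k
    using M_le[of k d] that d by (cases k) auto
  have ex: "\<exists>k. 1 \<le> k \<and> k \<le> n \<and> ew n d k = 0" using M_in[of d] d by auto
  define j where "j = (LEAST k. 1 \<le> k \<and> k \<le> n \<and> ew n d k = 0)"
  have j: "1 \<le> j" "j \<le> n" "ew n d j = 0" using LeastI_ex[OF ex] by (auto simp: j_def)
  have "j = n"
  proof (rule ccontr)
    assume "j \<noteq> n"
    then have jn: "j < n" using j by simp
    obtain i where i: "j = Suc i" using j by (cases j) auto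
    have "i \<noteq> 0"
    proof
      assume "i = 0"
      moreover have "0 < ew n d 1" using step[of d 0] f_neg[OF dl] by simp
      ultimately show False using i j by simp
    qed
    then have "ew n d i \<noteq> 0"
      using not_less_Least[of i "\<lambda>k. 1 \<le> k \<and> k \<le> n \<and> ew n d k = 0"] i j by (auto simp: j_def)
    then have wi: "0 < ew n d i" using nonneg[of i] i j by simp
    have fpos: "0 < f (eu n d i)"
      using step'[of d i] wi i j by (cases "f (eu n d i) \<le> 0") auto
    have "eu n d j = eu n d i" using i j by (simp add: eu_Suc)
    then have "ew n d (Suc j) < 0" using fpos j n by (simp add: ew_Suc)
    with nonneg[of "Suc j"] jn show False by simp
  qed
  with j dl nonneg show ?thesis unfolding n_def by blast
qed

text \<open>An orbit staying below \<open>u0\<close> has \<open>f < 0\<close> at every node, so its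
  flux would increase strictly from 0.\<close>

lemma eu_end_ge:
  assumes n: "0 < n" and d: "lo < d" "d < u0" and wn: "ew n d n = 0"
  shows "u0 \<le> eu n d n"
proof (rule ccontr)
  assume "\<not> u0 \<le> eu n d n"
  then have lt: "eu n d k < u0" if "k \<le> n" for k using eu_mono[OF that, of n d] by simp
  have "0 < ew n d (Suc k)" if "k < n" for k
    using that
  proof (induction k)
    case (Suc k)
    have "f (eu n d (Suc k)) < 0" using lt[of "Suc k"] Suc.prems eu_ge[of d n "Suc k"] d by (intro f_neg) auto
    then have "(1 / n) * (Suc (Suc k) / n) ^ m * f (eu n d (Suc k)) < 0"
      using n by (intro mult_pos_neg) auto
    then show ?case using Suc unfolding ew_Suc[of n d "Suc k"] by simp
  next
    case 0
    then show ?case using n f_neg[OF d] by (simp add: ew_Suc mult_pos_neg divide_neg_pos)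
  qed
  from this[of "n - 1"] wn n show False by simp
qed

text \<open>A discrete Gronwall estimate. By \<open>f_hom\<close> and the monotonicity of the orbit
  the slope is at most \<open>K powr \<alpha>\<close> times the current value, because
  \<open>psi\<close> undoes the power \<open>1 / \<alpha>\<close>. Over the unit interval the orbit
  grows at most by the factor \<open>exp L\<close>, yet it must reach \<open>u0\<close>.\<close>

lemma initial_value_bound:
  "\<exists>c>0. \<forall>n>0. \<forall>d. lo < d \<and> d < u0 \<and> ew n d n = 0 \<longrightarrow> c \<le> d"
proof -
  obtain K where K: "0 < K" "\<And>s. 0 \<le> s \<Longrightarrow> s \<le> u0 \<Longrightarrow> - f s \<le> K * s powr (1 / \<alpha>)"
    using f_hom by auto
  define L where "L = K powr \<alpha>"
  have L: "0 \<le> L" by (simp add: L_def)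
  have "u0 * exp (- L) \<le> d" if n: "0 < n" and d: "lo < d" "d < u0" and wn: "ew n d n = 0" for n d
  proof -
    \<comment> \<open>\<open>f_hom\<close> is available on \<open>{0..u0}\<close> only, so the
      estimate is run up to the first node that reaches \<open>u0\<close>.\<close>
    define k where "k = (LEAST k. u0 \<le> eu n d k)"
    have k: "u0 \<le> eu n d k" "k \<le> n"
      using eu_end_ge[OF n d wn] by (auto simp: k_def intro: LeastI Least_le)
    have lt: "eu n d j < u0" if "j < k" for j
      using not_less_Least[of j "\<lambda>k. u0 \<le> eu n d k"] that by (simp add: k_def)
    have d0: "0 < d" using d lo by simp
    have "eu n d j \<le> (1 + L / n) ^ j * d" if "j \<le> k" for j
      using that
    proof (induction j)
      case (Suc j)
      let ?b = "K * eu n d j powr (1 / \<alpha>)"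
      have uj: "0 < eu n d j" using eu_ge[of d n j] d0 by simp
      have "psi (ew n d (Suc j) / (Suc j / n) ^ m) \<le> psi ?b"
      proof (rule slope_le[OF n])
        fix i assume i: "i < Suc j"
        have ui: "0 < eu n d i" using eu_ge[of d n i] d0 by simp
        have "- f (eu n d i) \<le> K * eu n d i powr (1 / \<alpha>)"
          using K(2)[of "eu n d i"] ui lt[of i] i Suc.prems by simp
        also have "\<dots> \<le> ?b"
          using K ui i alpha eu_mono[of i j n d] by (intro mult_left_mono powr_mono2) auto
        finally show "- f (eu n d i) \<le> ?b" .
      qed (use Suc.prems k K in auto)
      also have "\<dots> = L * eu n d j"
        using K uj alpha by (simp add: psi_def L_def powr_mult powr_powr)
      finally have "eu n d (Suc j) \<le> eu n d j + (1 / n) * (L * eu n d j)"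
        unfolding eu_Suc by (intro add_mono mult_left_mono) auto
      also have "\<dots> = (1 + L / n) * eu n d j" by (simp add: algebra_simps)
      also have "\<dots> \<le> (1 + L / n) * ((1 + L / n) ^ j * d)"
        using Suc L by (intro mult_left_mono) auto
      finally show ?case by simp
    qed simp
    from this[of k] have "eu n d k \<le> (1 + L / n) ^ k * d" by simp
    also have "\<dots> \<le> (1 + L / n) ^ n * d"
      using k L d0 by (intro mult_right_mono power_increasing) auto
    also have "\<dots> \<le> exp L * d"
      using n L d0 exp_ge_one_plus_x_over_n_power_n[of n L] by (intro mult_right_mono) auto
    finally have "u0 \<le> exp L * d" using k by simp
    then show ?thesis by (simp add: exp_minus field_simps)
  qed
  moreover have "0 < u0 * exp (- L)" using lo by simp
  ultimately show ?thesis by blast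
qed

end

subsection \<open>Passage to the limit\<close>

text \<open>The extension is the lower envelope of the cones
  \<open>x k + L * \<bar>r - t k\<bar>\<close>: each of them is Lipschitz with constant
  \<open>L\<close>, and the compatibility of the data keeps the envelope from falling below
  \<open>x k\<close> at \<open>t k\<close>. It turns Euler orbits into functions on the line with a
  common Lipschitz constant.\<close>

lemma mcshane_extension:
  fixes x t :: "'i \<Rightarrow> real"
  assumes A: "finite A" "A \<noteq> {}" and L: "0 \<le> L"
    and lip: "\<And>k l. k \<in> A \<Longrightarrow> l \<in> A \<Longrightarrow> x k - x l \<le> L * \<bar>t k - t l\<bar>"
  obtains X where "\<And>k. k \<in> A \<Longrightarrow> X (t k) = x k" "\<And>r s. \<bar>X r - X s\<bar> \<le> L * \<bar>r - s\<bar>"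
proof
  define X where "X r = Min ((\<lambda>k. x k + L * \<bar>r - t k\<bar>) ` A)" for r
  have fin: "finite ((\<lambda>k. x k + L * \<bar>r - t k\<bar>) ` A)" "(\<lambda>k. x k + L * \<bar>r - t k\<bar>) ` A \<noteq> {}" for r
    using A by auto
  show "X (t k) = x k" if "k \<in> A" for k
  proof (rule antisym)
    show "X (t k) \<le> x k"
      unfolding X_def using that fin by (auto simp: Min_le_iff intro!: bexI[of _ k])
    show "x k \<le> X (t k)"
      unfolding X_def using that lip[of k] fin by (auto simp: Min_ge_iff algebra_simps)
  qed
  have one: "X r - X s \<le> L * \<bar>r - s\<bar>" for r s
  proof -
    obtain k where k: "k \<in> A" "X s = x k + L * \<bar>s - t k\<bar>"
      using Min_in[OF fin[of s]] by (auto simp: X_def)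
    have "X r \<le> x k + L * \<bar>r - t k\<bar>"
      unfolding X_def using fin k by (intro Min_le) auto
    moreover have "L * \<bar>r - t k\<bar> \<le> L * (\<bar>r - s\<bar> + \<bar>s - t k\<bar>)"
      using L by (intro mult_left_mono) auto
    ultimately show ?thesis using k by (simp add: algebra_simps)
  qed
  show "\<bar>X r - X s\<bar> \<le> L * \<bar>r - s\<bar>" for r s
    using one[of r s] one[of s r] by (simp add: abs_minus_commute abs_le_iff)
qed

text \<open>The integrand is the step function with the value \<open>c j\<close> on the cell from
  \<open>j / n\<close> to \<open>(j + 1) / n\<close>, so Euler sums become integrals.\<close>

lemma has_integral_step:
  fixes c :: "nat \<Rightarrow> real"
  assumes n: "0 < n"
  shows "((\<lambda>s. c (nat \<lfloor>real n * s\<rfloor>)) has_integral (1 / n) * (\<Sum>j<k. c j)) {0..k / n}"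
proof (induction k)
  case 0
  then show ?case using has_integral_refl(2)[of "\<lambda>s. c (nat \<lfloor>real n * s\<rfloor>)" 0] by simp
next
  case (Suc k)
  have "((\<lambda>s. c k) has_integral (1 / n) * c k) {k / n..Suc k / n}"
    using has_integral_const_real[of "c k" "k / n" "Suc k / n"] n
    by (simp add: diff_divide_distrib add_divide_distrib divide_right_mono)
  then have "((\<lambda>s. c (nat \<lfloor>real n * s\<rfloor>)) has_integral (1 / n) * c k) {k / n..Suc k / n}"
  \<comment> \<open>The step function already has the next value at the right end of the cell; one
    point does not affect the integral.\<close>
  proof (rule has_integral_spike_finite[of "{Suc k / n}", rotated 2])
    fix s assume "s \<in> {k / n..Suc k / n} - {Suc k / n}"
    then have "k / n \<le> s" "s < Suc k / n" by auto
    then have "real k \<le> real n * s" "real n * s < real k + 1" using n by (auto simp: field_simps)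
    then have "\<lfloor>real n * s\<rfloor> = int k" by (simp add: floor_eq_iff)
    then show "c (nat \<lfloor>real n * s\<rfloor>) = c k" by simp
  qed simp
  with Suc have "((\<lambda>s. c (nat \<lfloor>real n * s\<rfloor>)) has_integral (1 / n) * (\<Sum>j<k. c j) + (1 / n) * c k) {0..Suc k / n}"
    by (intro has_integral_combine[where c = "k / n"]) (auto simp: divide_right_mono)
  then show ?case by (simp add: distrib_left)
qed

lemma floor_div_tendsto:
  assumes n: "filterlim n at_top sequentially" and r: "0 \<le> r"
  shows "(\<lambda>i. real (nat \<lfloor>real (n i) * r\<rfloor>) / real (n i)) \<longlonglongrightarrow> r"
proof (rule tendsto_sandwich)
  have ev: "\<forall>\<^sub>F i in sequentially. 0 < n i" using n by (simp add: filterlim_at_top eventually_gt_at_top filterlim_iff)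
  have fl: "real (nat \<lfloor>real (n i) * r\<rfloor>) = of_int \<lfloor>real (n i) * r\<rfloor>" for i
    using r by simp
  show "\<forall>\<^sub>F i in sequentially. r - 1 / n i \<le> real (nat \<lfloor>real (n i) * r\<rfloor>) / real (n i)"
    using ev
  proof eventually_elim
    case (elim i)
    have "real (n i) * r - 1 \<le> of_int \<lfloor>real (n i) * r\<rfloor>" by linarith
    then have "(real (n i) * r - 1) / n i \<le> of_int \<lfloor>real (n i) * r\<rfloor> / n i"
      by (rule divide_right_mono) simp
    with elim show ?case unfolding fl by (simp add: diff_divide_distrib)
  qed
  show "\<forall>\<^sub>F i in sequentially. real (nat \<lfloor>real (n i) * r\<rfloor>) / real (n i) \<le> r"
    using ev
  proof eventually_elim
    case (elim i)
    have "of_int \<lfloor>real (n i) * r\<rfloor> \<le> real (n i) * r" by linarith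
    with elim show ?case unfolding fl by (simp add: field_simps)
  qed
  have "filterlim (\<lambda>i. real (n i)) at_top sequentially"
    by (rule filterlim_compose[OF filterlim_real_sequentially n])
  then have "(\<lambda>i. 1 / real (n i)) \<longlonglongrightarrow> 0"
    by (intro real_tendsto_divide_at_top[OF tendsto_const])
  then show "(\<lambda>i. r - 1 / real (n i)) \<longlonglongrightarrow> r"
    using tendsto_diff[OF tendsto_const[of r], of "\<lambda>i. 1 / real (n i)" 0] by simp
qed simp

text \<open>The sums are integrals of step functions, to which dominated convergence applies.
  Convergence is asked at interior points only, because the slope \<open>psi (W r / r ^ m)\<close>
  has a quotient that degenerates at the centre. The cutoff at \<open>k i / n i\<close> discards the
  incomplete last cell.\<close>

lemma step_sum_tendsto:
  fixes c :: "nat \<Rightarrow> nat \<Rightarrow> real" and F :: "real \<Rightarrow> real"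
  assumes n: "filterlim n at_top sequentially" "\<And>i. 0 < n i"
    and bnd: "\<And>i j. j < n i \<Longrightarrow> \<bar>c i j\<bar> \<le> B"
    and lim: "\<And>s. 0 < s \<Longrightarrow> s < 1 \<Longrightarrow> (\<lambda>i. c i (nat \<lfloor>real (n i) * s\<rfloor>)) \<longlonglongrightarrow> F s"
    and r: "0 \<le> r" "r \<le> 1"
  shows "(\<lambda>i. (1 / n i) * (\<Sum>j<nat \<lfloor>real (n i) * r\<rfloor>. c i j)) \<longlonglongrightarrow> integral {0..r} F"
proof -
  define k where "k i = nat \<lfloor>real (n i) * r\<rfloor>" for i
  have k: "real (k i) / n i \<le> r" for i
  proof -
    have "real (k i) \<le> real (n i) * r" using r by (simp add: k_def)
    then show ?thesis using n(2)[of i] by (simp add: field_simps)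
  qed
  define h where "h i s = (if s \<in> {0..k i / n i} then c i (nat \<lfloor>real (n i) * s\<rfloor>) else 0)" for i s
  have hint: "(h i has_integral (1 / n i) * (\<Sum>j<k i. c i j)) {0<..<r}" for i
  proof -
    have "(h i has_integral (1 / n i) * (\<Sum>j<k i. c i j)) {0..r}"
      unfolding h_def
      using has_integral_step[OF n(2)[of i], of "c i" "k i"] k[of i]
      by (subst has_integral_restrict) auto
    then show ?thesis by (simp add: has_integral_Icc_iff_Ioo)
  qed
  have "(\<lambda>i. integral {0<..<r} (h i)) \<longlonglongrightarrow> integral {0<..<r} F"
  proof (rule dominated_convergence(2)[where h = "\<lambda>_. max B 0"])
    show "h i integrable_on {0<..<r}" for i using hint by blast
    show "(\<lambda>_. max B 0) integrable_on {0<..<r}"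
      using integrable_on_Icc_iff_Ioo integrable_const_ivl by blast
    show "norm (h i s) \<le> max B 0" if "s \<in> {0<..<r}" for i s
    proof -
      have "real (n i) * s < real (n i) * 1" using that r n(2)[of i] by (intro mult_strict_left_mono) auto
      then have "nat \<lfloor>real (n i) * s\<rfloor> < n i" using that by (simp add: nat_less_iff floor_less_iff)
      then show ?thesis using bnd[of _ i] by (auto simp: h_def le_max_iff_disj)
    qed
    show "(\<lambda>i. h i s) \<longlonglongrightarrow> F s" if s: "s \<in> {0<..<r}" for s
    proof -
      have "(\<lambda>i. real (k i) / n i) \<longlonglongrightarrow> r"
        unfolding k_def by (rule floor_div_tendsto[OF n(1) r(1)])
      then have "\<forall>\<^sub>F i in sequentially. s < real (k i) / n i"
        using s by (intro order_tendstoD(1)) auto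
      then have "\<forall>\<^sub>F i in sequentially. c i (nat \<lfloor>real (n i) * s\<rfloor>) = h i s"
        by eventually_elim (use s in \<open>auto simp: h_def\<close>)
      with lim[of s] s r show ?thesis by (auto intro: Lim_transform_eventually)
    qed
  qed
  moreover have "integral {0<..<r} (h i) = (1 / n i) * (\<Sum>j<k i. c i j)" for i
    using hint by blast
  ultimately show ?thesis
    by (simp add: k_def integral_open_interval_real)
qed


section \<open>The limit profile\<close>

context euler_shooting
begin

text \<open>Interpolated orbits converge uniformly along a subsequence by Arzela-Ascoli. The Euler
  sums then converge to integral equations for \<open>W\<close> and \<open>U\<close>, and
  differentiating these gives the system.\<close>

lemma profile_exists:
  "\<exists>U W.
     (\<forall>r\<in>{0..1}. (U has_real_derivative psi (W r / r ^ m)) (at r within {0..1})) \<and>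
     (\<forall>r\<in>{0..1}. (W has_real_derivative - (r ^ m * f (U r))) (at r within {0..1})) \<and>
     (\<forall>r\<in>{0..1}. 0 \<le> W r \<and> W r \<le> C * r * r ^ m) \<and> W 1 = 0 \<and>
     continuous_on {0..1} (\<lambda>r. psi (W r / r ^ m)) \<and> mono_on {0..1} U \<and> lo \<le> U 0 \<and> 0 < U 0 \<and> U 0 < u0 \<and> u0 \<le> U 1"
proof -
  define N where "N i = 5 * Suc i" for i
  have N_pos: "0 < N i" for i by (simp add: N_def)
  have "\<forall>i. \<exists>d. lo < d \<and> d < u0 \<and> (\<forall>k\<le>N i. 0 \<le> ew (N i) d k) \<and> ew (N i) d (N i) = 0"
    unfolding N_def by (intro allI shooting_discrete) simp
  then obtain D where DD: "\<forall>i. lo < D i \<and> D i < u0 \<and> (\<forall>k\<le>N i. 0 \<le> ew (N i) (D i) k) \<and> ew (N i) (D i) (N i) = 0"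
    unfolding choice_iff by (elim exE)
  have D: "lo < D i" "D i < u0" "k \<le> N i \<Longrightarrow> 0 \<le> ew (N i) (D i) k" "ew (N i) (D i) (N i) = 0" for i k
    using DD by simp_all
  have L0: "0 \<le> psi C" by (rule psi_nonneg)
  have "\<forall>i. \<exists>X. (\<forall>k\<in>{..N i}. X (real k / N i) = eu (N i) (D i) k) \<and> (\<forall>r s. \<bar>X r - X s\<bar> \<le> psi C * \<bar>r - s\<bar>)"
  proof
    fix i
    have lip: "eu (N i) (D i) k - eu (N i) (D i) l \<le> psi C * \<bar>real k / N i - real l / N i\<bar>"
      if "k \<in> {..N i}" "l \<in> {..N i}" for k l
    proof (cases "l \<le> k")
      case True
      have "real l / N i \<le> real k / N i" using True by (simp add: divide_right_mono)
      then show ?thesis using eu_lipschitz[OF N_pos True, of i "D i"] that by simp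
    next
      case False
      then have "eu (N i) (D i) k - eu (N i) (D i) l \<le> 0" using eu_mono[of k l "N i" "D i"] by simp
      also have "\<dots> \<le> psi C * \<bar>real k / N i - real l / N i\<bar>" using L0 by simp
      finally show ?thesis .
    qed
    obtain X where "\<And>k. k \<in> {..N i} \<Longrightarrow> X (real k / N i) = eu (N i) (D i) k"
      "\<And>r s. \<bar>X r - X s\<bar> \<le> psi C * \<bar>r - s\<bar>"
      by (rule mcshane_extension[OF _ _ L0 lip, of "{..N i}"]) auto
    then show "\<exists>X. (\<forall>k\<in>{..N i}. X (real k / N i) = eu (N i) (D i) k) \<and> (\<forall>r s. \<bar>X r - X s\<bar> \<le> psi C * \<bar>r - s\<bar>)"
      by blast
  qed
  then obtain X where XX: "\<forall>i. (\<forall>k\<in>{..N i}. X i (real k / N i) = eu (N i) (D i) k) \<and>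
      (\<forall>r s. \<bar>X i r - X i s\<bar> \<le> psi C * \<bar>r - s\<bar>)"
    unfolding choice_iff by (elim exE)
  have X: "X i (real k / N i) = eu (N i) (D i) k" if "k \<le> N i" for i k
    using XX that by simp
  have X_lip: "\<bar>X i r - X i s\<bar> \<le> psi C * \<bar>r - s\<bar>" for i r s
    using XX by simp
  have X0: "X i 0 = D i" for i using X[of 0 i] by simp
  have Xbnd: "norm (X i r) \<le> u0 + psi C" if "r \<in> {0..1}" for i r
  proof -
    have "psi C * \<bar>r - 0\<bar> \<le> psi C * 1" using that L0 by (intro mult_left_mono) auto
    then show ?thesis using X_lip[of i r 0] X0[of i] D(1,2)[of i] lo by (auto simp: abs_le_iff)
  qed
  obtain U k where U: "continuous_on {0..1} U" "strict_mono (k :: nat \<Rightarrow> nat)"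
    "\<And>e. 0 < e \<Longrightarrow> \<exists>M. \<forall>i r. i \<ge> M \<and> r \<in> {0..1} \<longrightarrow> norm (X (k i) r - U r) < e"
  proof (rule Arzela_Ascoli[of "{0..1::real}" X "u0 + psi C"])
    fix r e :: real assume e: "0 < e"
    show "\<exists>d>0. \<forall>i s. s \<in> {0..1} \<and> norm (r - s) < d \<longrightarrow> norm (X i r - X i s) < e"
    proof (intro exI[of _ "e / (psi C + 1)"] conjI allI impI)
      fix i s assume "s \<in> {0..1} \<and> norm (r - s) < e / (psi C + 1)"
      then have "(psi C + 1) * \<bar>r - s\<bar> < e" using L0 by (simp add: field_simps)
      moreover have "psi C * \<bar>r - s\<bar> \<le> (psi C + 1) * \<bar>r - s\<bar>" by (simp add: mult_right_mono)
      ultimately show "norm (X i r - X i s) < e" using X_lip[of i r s] by simp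
    qed (use e L0 in simp)
  qed (use Xbnd in auto)
  \<comment> \<open>From here on \<open>n\<close>, \<open>x\<close> and \<open>w\<close> refer to
    the convergent subsequence.\<close>
  define n where "n i = N (k i)" for i
  define x where "x i = eu (n i) (D (k i))" for i
  define w where "w i = ew (n i) (D (k i))" for i
  have n_pos: "0 < n i" for i by (simp add: n_def N_pos)
  have n_lim: "filterlim n at_top sequentially"
  proof -
    have "strict_mono n" using U(2) by (auto simp: strict_mono_def n_def N_def)
    then show ?thesis by (rule filterlim_subseq)
  qed
  have w0: "0 \<le> w i j" if "j \<le> n i" for i j using D(3) that by (simp add: w_def n_def)
  have fl_le: "nat \<lfloor>real (n i) * r\<rfloor> \<le> n i" if "0 \<le> r" "r \<le> 1" for i r
  proof -
    have "real (n i) * r \<le> real (n i) * 1" using that by (intro mult_left_mono) auto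
    then show ?thesis by (simp add: floor_le_iff nat_le_iff)
  qed
  \<comment> \<open>The node belonging to a radius moves with the mesh, so convergence is needed
    along arguments \<open>s i\<close> tending to \<open>r\<close>; the common Lipschitz constant
    supplies it.\<close>
  have Xlim: "(\<lambda>i. X (k i) (s i)) \<longlonglongrightarrow> U r"
    if "s \<longlonglongrightarrow> r" "r \<in> {0..1}" for s r
  proof -
    have "(\<lambda>i. X (k i) r) \<longlonglongrightarrow> U r"
    proof (rule LIMSEQ_I)
      fix e :: real assume "0 < e"
      from U(3)[OF this] show "\<exists>M. \<forall>i\<ge>M. norm (X (k i) r - U r) < e" using that(2) by blast
    qed
    moreover have "(\<lambda>i. X (k i) (s i) - X (k i) r) \<longlonglongrightarrow> 0"
    proof (rule Lim_null_comparison)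
      show "\<forall>\<^sub>F i in sequentially. norm (X (k i) (s i) - X (k i) r) \<le> psi C * \<bar>s i - r\<bar>"
        using X_lip by simp
      show "(\<lambda>i. psi C * \<bar>s i - r\<bar>) \<longlonglongrightarrow> 0"
        using tendsto_mult_right_zero[OF tendsto_rabs_zero[OF LIM_zero[OF that(1)]]] .
    qed
    ultimately have "(\<lambda>i. X (k i) r + (X (k i) (s i) - X (k i) r)) \<longlonglongrightarrow> U r + 0"
      by (rule tendsto_add)
    then show ?thesis by simp
  qed
  have x_lim: "(\<lambda>i. x i (nat \<lfloor>real (n i) * r\<rfloor>)) \<longlonglongrightarrow> U r" if r: "0 \<le> r" "r \<le> 1" for r
  proof -
    have "x i (nat \<lfloor>real (n i) * r\<rfloor>) = X (k i) (real (nat \<lfloor>real (n i) * r\<rfloor>) / n i)" for i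
      using X fl_le[OF r, of i] by (simp add: x_def n_def)
    then show ?thesis using Xlim[OF floor_div_tendsto[OF n_lim r(1)]] r by simp
  qed
  have D_lim: "(\<lambda>i. D (k i)) \<longlonglongrightarrow> U 0"
    using x_lim[of 0] by (simp add: x_def)
  have U_mono: "mono_on {0..1} U"
  proof (rule mono_onI)
    fix r s :: real assume rs: "r \<in> {0..1}" "s \<in> {0..1}" "r \<le> s"
    have "x i (nat \<lfloor>real (n i) * r\<rfloor>) \<le> x i (nat \<lfloor>real (n i) * s\<rfloor>)" for i
      unfolding x_def using rs by (intro eu_mono nat_mono floor_mono mult_left_mono) auto
    then show "U r \<le> U s"
      using x_lim[of r] x_lim[of s] rs by (intro LIMSEQ_le[of _ "U r" _ "U s"]) auto
  qed
  have U0: "lo \<le> U 0" "U 0 \<le> u0"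
    using LIMSEQ_le_const[OF D_lim, of lo] LIMSEQ_le_const2[OF D_lim, of u0] D(1,2)
    by (auto simp: less_imp_le)
  have U0_pos: "0 < U 0"
  proof -
    obtain c where c: "0 < c" "\<And>n d. 0 < n \<Longrightarrow> lo < d \<Longrightarrow> d < u0 \<Longrightarrow> ew n d n = 0 \<Longrightarrow> c \<le> d"
      using initial_value_bound by blast
    have "c \<le> D i" for i using c(2)[OF N_pos D(1,2,4)] .
    then have "c \<le> U 0" using LIMSEQ_le_const[OF D_lim, of c] by auto
    with c show ?thesis by simp
  qed
  have U1: "u0 \<le> U 1"
  proof -
    have "u0 \<le> x i (n i)" for i
      unfolding x_def n_def by (rule eu_end_ge[OF N_pos D(1,2,4)])
    then show ?thesis using LIMSEQ_le_const[OF x_lim[of 1], of u0] by auto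
  qed
  have f_at: "isCont f s" for s using f_cont by (simp add: continuous_on_eq_continuous_at)
  \<comment> \<open>All orbits remain in one compact interval, so \<open>f\<close> is bounded along
    them however fast it grows.\<close>
  obtain B where B: "\<And>i j. j \<le> n i \<Longrightarrow> \<bar>f (x i j)\<bar> \<le> B"
  proof -
    have "compact (f ` {- (u0 + psi C)..u0 + psi C})"
      by (intro compact_continuous_image continuous_on_subset[OF f_cont]) auto
    then obtain B where "\<forall>t\<in>f ` {- (u0 + psi C)..u0 + psi C}. norm t \<le> B"
      using compact_imp_bounded bounded_iff by blast
    then have B: "\<bar>f s\<bar> \<le> B" if "\<bar>s\<bar> \<le> u0 + psi C" for s
      using that by (force simp: abs_le_iff)
    have "\<bar>x i j\<bar> \<le> u0 + psi C" if "j \<le> n i" for i j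
      using Xbnd[of "real j / n i" "k i"] X[of j "k i"] that n_pos[of i] by (simp add: x_def n_def)
    with B that show thesis by blast
  qed
  define cw where "cw i j = - ((real (Suc j) / n i) ^ m * f (x i j))" for i j
  have cw_bnd: "\<bar>cw i j\<bar> \<le> B" if "j < n i" for i j
  proof -
    have "(real (Suc j) / n i) ^ m * \<bar>f (x i j)\<bar> \<le> 1 * B"
      using that n_pos[of i] B[of j i] by (intro mult_mono power_le_one) auto
    then show ?thesis using n_pos[of i] by (simp add: cw_def abs_mult)
  qed
  have w_sum: "w i j = (1 / n i) * (\<Sum>l<j. cw i l)" for i j
    unfolding w_def x_def cw_def ew_eq_sum by (simp add: sum_distrib_left)
  have inv_lim: "(\<lambda>i. 1 / real (n i)) \<longlonglongrightarrow> 0"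
  proof -
    have "filterlim (\<lambda>i. real (n i)) at_top sequentially"
      by (rule filterlim_compose[OF filterlim_real_sequentially n_lim])
    then show ?thesis by (intro real_tendsto_divide_at_top[OF tendsto_const])
  qed
  have suc_lim: "(\<lambda>i. real (Suc (nat \<lfloor>real (n i) * s\<rfloor>)) / n i) \<longlonglongrightarrow> s" if "0 \<le> s" for s
    using tendsto_add[OF floor_div_tendsto[OF n_lim that] inv_lim]
    by (simp add: add_divide_distrib add.commute)
  have cw_lim: "(\<lambda>i. cw i (nat \<lfloor>real (n i) * s\<rfloor>)) \<longlonglongrightarrow> - (s ^ m * f (U s))" if "0 \<le> s" "s \<le> 1" for s
    unfolding cw_def using that
    by (intro tendsto_intros suc_lim isCont_tendsto_compose[OF f_at] x_lim)
  define W where "W r = integral {0..r} (\<lambda>s. - (s ^ m * f (U s)))" for r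
  have w_lim: "(\<lambda>i. w i (nat \<lfloor>real (n i) * r\<rfloor>)) \<longlonglongrightarrow> W r" if "0 \<le> r" "r \<le> 1" for r
    unfolding w_sum W_def using that cw_bnd cw_lim n_lim n_pos
    by (intro step_sum_tendsto[where B = B]) auto
  have W_ge: "0 \<le> W r" if "0 \<le> r" "r \<le> 1" for r
    using LIMSEQ_le_const[OF w_lim[OF that], of 0] w0 fl_le[OF that] by auto
  have W_le: "W r \<le> C * r * r ^ m" if "0 \<le> r" "r \<le> 1" for r
  proof (rule LIMSEQ_le[OF w_lim[OF that]])
    let ?t = "\<lambda>i. real (nat \<lfloor>real (n i) * r\<rfloor>) / n i"
    show "(\<lambda>i. C * ?t i * ?t i ^ m) \<longlonglongrightarrow> C * r * r ^ m"
      by (intro tendsto_intros floor_div_tendsto n_lim that)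
    have "w i (nat \<lfloor>real (n i) * r\<rfloor>) \<le> C * ?t i * ?t i ^ m" for i
      unfolding w_def using C_pos f_lower n_pos by (intro ew_le) (auto simp: minus_le_iff)
    then show "\<exists>M. \<forall>i\<ge>M. w i (nat \<lfloor>real (n i) * r\<rfloor>) \<le> C * ?t i * ?t i ^ m" by blast
  qed
  have W1: "W 1 = 0"
  proof -
    have "(\<lambda>i. w i (n i)) \<longlonglongrightarrow> W 1" using w_lim[of 1] by simp
    moreover have "w i (n i) = 0" for i using D(4) by (simp add: w_def n_def)
    ultimately show ?thesis by (simp add: LIMSEQ_const_iff)
  qed
  have fU_cont: "continuous_on {0..1} (\<lambda>s. - (s ^ m * f (U s)))"
    by (intro continuous_intros continuous_on_compose2[OF f_cont] U(1)) auto
  have W_deriv: "(W has_real_derivative - (r ^ m * f (U r))) (at r within {0..1})" if "r \<in> {0..1}" for r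
    unfolding W_def[abs_def] using integral_has_real_derivative[OF fU_cont that] .
  have W_cont: "continuous_on {0..1} W"
    using W_deriv by (intro DERIV_continuous_on) auto
  define V where "V r = psi (W r / r ^ m)" for r
  have V_lim: "(\<lambda>i. psi (w i (Suc (nat \<lfloor>real (n i) * s\<rfloor>)) / (real (Suc (nat \<lfloor>real (n i) * s\<rfloor>)) / n i) ^ m)) \<longlonglongrightarrow> V s"
    if s: "0 < s" "s < 1" for s
  proof -
    let ?j = "\<lambda>i. nat \<lfloor>real (n i) * s\<rfloor>"
    have psi_at: "isCont psi t" for t using continuous_on_psi by (simp add: continuous_on_eq_continuous_at)
    \<comment> \<open>The slope in a cell uses the flux at its right end, which differs from the
      flux at its left end by a term of order \<open>1 / n\<close>.\<close>
    have "(\<lambda>i. w i (?j i) + (1 / n i) * cw i (?j i)) \<longlonglongrightarrow> W s + 0 * - (s ^ m * f (U s))"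
      using s by (intro tendsto_add tendsto_mult inv_lim w_lim cw_lim) auto
    then have "(\<lambda>i. w i (Suc (?j i))) \<longlonglongrightarrow> W s"
      unfolding w_sum by (simp add: distrib_left)
    then show ?thesis unfolding V_def
      using s by (intro isCont_tendsto_compose[OF psi_at] tendsto_divide tendsto_power suc_lim) auto
  qed
  have U_int: "U r = U 0 + integral {0..r} V" if r: "0 \<le> r" "r \<le> 1" for r
  proof -
    define cu where "cu i j = psi (w i (Suc j) / (real (Suc j) / n i) ^ m)" for i j
    have "\<bar>cu i j\<bar> \<le> psi C" if "j < n i" for i j
    proof -
      have "cu i j \<le> psi C"
        unfolding cu_def w_def using that n_pos C_pos f_lower
        by (intro slope_le) (auto simp: minus_le_iff)
      then show ?thesis using psi_nonneg by (simp add: cu_def)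
    qed
    then have "(\<lambda>i. (1 / n i) * (\<Sum>j<nat \<lfloor>real (n i) * r\<rfloor>. cu i j)) \<longlonglongrightarrow> integral {0..r} V"
      using V_lim r n_lim n_pos by (intro step_sum_tendsto[where B = "psi C"]) (auto simp: cu_def)
    moreover have "(1 / n i) * (\<Sum>j<l. cu i j) = x i l - D (k i)" for i l
      using eu_diff[of 0 l "n i" "D (k i)"] by (simp add: cu_def x_def w_def atLeast0LessThan)
    ultimately have "(\<lambda>i. x i (nat \<lfloor>real (n i) * r\<rfloor>) - D (k i)) \<longlonglongrightarrow> integral {0..r} V" by simp
    moreover have "(\<lambda>i. x i (nat \<lfloor>real (n i) * r\<rfloor>) - D (k i)) \<longlonglongrightarrow> U r - U 0"
      using r by (intro tendsto_diff x_lim D_lim)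
    ultimately show ?thesis using LIMSEQ_unique by fastforce
  qed
  have W0: "W 0 = 0" using W_ge[of 0] W_le[of 0] by simp
  have V_cont: "continuous_on {0..1} V"
  proof -
    have "continuous (at r within {0..1}) (\<lambda>r. W r / r ^ m)" if r: "r \<in> {0..1}" for r
    proof (cases "r = 0")
      case False
      have "continuous (at r within {0..1}) W"
        using W_cont r by (simp add: continuous_on_eq_continuous_within)
      then show ?thesis using False by (intro continuous_intros) auto
    next
      case True
      \<comment> \<open>At the centre \<open>W r \<le> C * r * r ^ m\<close> forces the quotient to
        0, which agrees with its value there since \<open>W 0 = 0\<close>.\<close>
      have "((\<lambda>r. W r / r ^ m) \<longlongrightarrow> 0) (at 0 within {0..1})"
      proof (rule Lim_null_comparison)
        have "norm (W r / r ^ m) \<le> C * r" if "r \<in> {0..1}" "r \<noteq> 0" for r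
          using W_ge[of r] W_le[of r] that by (simp add: divide_le_eq)
        then show "\<forall>\<^sub>F r in at 0 within {0..1}. norm (W r / r ^ m) \<le> C * r"
          by (auto simp: eventually_at intro: exI[of _ 1])
        show "((\<lambda>r. C * r) \<longlongrightarrow> 0) (at 0 within {0..1})"
          by (auto intro!: tendsto_eq_intros)
      qed
      then show ?thesis using True W0 by (simp add: continuous_within)
    qed
    then have "continuous_on {0..1} (\<lambda>r. W r / r ^ m)"
      by (simp add: continuous_on_eq_continuous_within)
    then show ?thesis unfolding V_def[abs_def]
      by (intro continuous_on_compose2[OF continuous_on_psi]) auto
  qed
  have U_deriv: "(U has_real_derivative V r) (at r within {0..1})" if "r \<in> {0..1}" for r
  proof -
    have "((\<lambda>r. U 0 + integral {0..r} V) has_real_derivative V r) (at r within {0..1})"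
      using integral_has_real_derivative[OF V_cont that]
      by (auto intro!: derivative_eq_intros)
    then show ?thesis
      by (rule has_field_derivative_transform_within[OF _ zero_less_one that]) (simp add: U_int[symmetric])
  qed
  \<comment> \<open>The initial values lie below \<open>u0\<close>, but their limit might equal it.
    Then \<open>W\<close> and hence the slope vanish as long as \<open>U\<close> is near
    \<open>u0\<close>, so \<open>U\<close> is constant, and an Euler orbit uniformly close to
    \<open>u0\<close> would contradict \<open>no_small_orbit\<close>.\<close>
  have "U 0 \<noteq> u0"
  proof
    assume eq: "U 0 = u0"
    obtain a \<delta>0 where a: "0 < a" "0 < \<delta>0"
      "\<And>s. \<bar>s - u0\<bar> \<le> \<delta>0 \<Longrightarrow> a * (s - u0)\<^sup>2 \<le> f s * (s - u0)"
      using f_slope by auto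
    have "U 1 = u0"
    proof (rule ccontr)
      assume "U 1 \<noteq> u0"
      then have gt: "u0 < U 1" using U1 by simp
      \<comment> \<open>Capping at \<open>u0 + \<delta>0\<close> keeps the values of
        \<open>U\<close> up to \<open>s\<close> in the range where the slope inequality
        applies.\<close>
      define y where "y = min (U 1) (u0 + \<delta>0)"
      obtain s where s: "0 \<le> s" "s \<le> 1" "U s = y"
        using IVT'[of U 0 y 1] U(1) eq gt a by (auto simp: y_def)
      have fU: "0 \<le> f (U r)" if r: "0 \<le> r" "r \<le> s" for r
      proof -
        have "u0 \<le> U r" "U r \<le> y"
          using mono_onD[OF U_mono, of 0 r] mono_onD[OF U_mono, of r s] r s eq by auto
        moreover from this have "a * (U r - u0)\<^sup>2 \<le> f (U r) * (U r - u0)"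
          using a(3)[of "U r"] by (simp add: y_def)
        moreover have "0 \<le> a * (U r - u0)\<^sup>2" using a by simp
        ultimately have "0 \<le> f (U r) * (U r - u0)" by linarith
        then show ?thesis
          using \<open>u0 \<le> U r\<close> lo by (cases "U r = u0") (auto simp: zero_le_mult_iff)
      qed
      have "W r = 0" if r: "0 \<le> r" "r \<le> s" for r
      proof -
        have "integral {0..r} (\<lambda>t. - (t ^ m * f (U t))) \<le> 0"
          using fU r s by (intro integral_le[of _ _ "\<lambda>_. 0", simplified] integrable_continuous_real
              continuous_on_subset[OF fU_cont]) auto
        then show ?thesis using W_ge[of r] r s by (simp add: W_def)
      qed
      then have "integral {0..s} V = integral {0..s} (\<lambda>_. 0)"
        by (intro integral_cong) (auto simp: V_def)
      then have "U s = u0" using U_int[of s] s eq by simp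
      with s gt a show False by (auto simp: y_def)
    qed
    then have Uc: "U r = u0" if "r \<in> {0..1}" for r
      using mono_onD[OF U_mono, of 0 r] mono_onD[OF U_mono, of r 1] that eq by auto
    obtain \<delta> where \<delta>: "0 < \<delta>"
      "\<And>q d. 0 < q \<Longrightarrow> d < u0 \<Longrightarrow> \<not> (\<forall>k\<le>5 * q. 0 \<le> ew (5 * q) d k \<and> \<bar>eu (5 * q) d k - u0\<bar> \<le> \<delta>)"
      using no_small_orbit by blast
    obtain M where M: "\<And>r. r \<in> {0..1} \<Longrightarrow> \<bar>X (k M) r - U r\<bar> < \<delta>"
      using U(3)[OF \<delta>(1)] by auto
    have "\<bar>eu (n M) (D (k M)) j - u0\<bar> \<le> \<delta>" if "j \<le> n M" for j
    proof -
      have "real j / n M \<in> {0..1}" using that n_pos[of M] by simp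
      from M[OF this] Uc[OF this] show ?thesis using X[of j "k M"] that by (simp add: n_def)
    qed
    moreover have "0 \<le> ew (n M) (D (k M)) j" if "j \<le> n M" for j
      using w0[OF that] by (simp add: w_def)
    ultimately show False using \<delta>(2)[of "Suc (k M)" "D (k M)"] D(2) by (auto simp: n_def N_def)
  qed
  with U0 have "U 0 < u0" by simp
  show ?thesis
    using U_deriv W_deriv W_ge W_le W1 V_cont U_mono U0(1) U0_pos \<open>U 0 < u0\<close> U1
    by (intro exI[of _ U] exI[of _ W]) (auto simp: V_def)
qed

end

subsection \<open>Weak gradients\<close>

lemma has_derivative_zero_locally:
  fixes F :: "'a::real_normed_vector \<Rightarrow> 'b::real_normed_vector"
  assumes "open S" "x \<in> S" "\<And>y. y \<in> S \<Longrightarrow> F y = 0"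
  shows "(F has_derivative (\<lambda>_. 0)) (at x)"
  by (rule has_derivative_transform_within_open[where f = "\<lambda>_. 0", OF _ assms(1,2)]) (use assms in auto)

lemma gradient_unique:
  fixes F :: "'a::real_inner \<Rightarrow> real"
  assumes "(F has_derivative (\<lambda>h. D \<bullet> h)) (at x)" "(F has_derivative (\<lambda>h. E \<bullet> h)) (at x)"
  shows "D = E"
proof -
  have "(\<lambda>h. D \<bullet> h) = (\<lambda>h. E \<bullet> h)" by (rule has_derivative_unique[OF assms])
  then have "(D - E) \<bullet> (D - E) = 0" by (metis inner_diff_left right_minus_eq)
  then show ?thesis by simp
qed

lemma integrable_lebesgue_on_compact:
  fixes f :: "'a::euclidean_space \<Rightarrow> 'b::{banach, second_countable_topology}"
  assumes "compact K" "continuous_on K f"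
  shows "integrable (lebesgue_on K) f"
proof -
  have *: "integrable lborel (\<lambda>x. indicator K x *\<^sub>R f x)"
    by (rule borel_integrable_compact[OF assms])
  have "integrable lebesgue (\<lambda>x. indicator K x *\<^sub>R f x)"
    using * integrable_completion[OF borel_measurable_integrable[OF *]] by simp
  then show ?thesis
    using assms(1) by (subst integrable_restrict_space) (auto simp: lmeasurable_compact fmeasurableD)
qed

lemma integrable_lebesgue_on_compact_support:
  fixes f :: "'a::euclidean_space \<Rightarrow> 'b::{banach, second_countable_topology}"
  assumes K: "compact K" "K \<subseteq> U" and U: "U \<in> sets lebesgue"
    and f: "continuous_on K f" "\<And>x. x \<in> U - K \<Longrightarrow> f x = 0"
  shows "integrable (lebesgue_on U) f"
proof -
  have "integrable (lebesgue_on K) f" by (rule integrable_lebesgue_on_compact[OF K(1) f(1)])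
  then have "integrable lebesgue (\<lambda>x. indicator K x *\<^sub>R f x)"
    using K by (subst (asm) integrable_restrict_space) (auto simp: lmeasurable_compact fmeasurableD)
  also have "(\<lambda>x. indicator K x *\<^sub>R f x) = (\<lambda>x. indicator U x *\<^sub>R f x)"
    using K f(2) by (auto simp: fun_eq_iff indicator_def)
  finally show ?thesis using U by (subst integrable_restrict_space) auto
qed

section \<open>Integration by parts\<close>

text \<open>Difference quotients of \<open>F\<close> have integral 0 by translation invariance, and
  they converge to the directional derivative under a bounded, compactly supported majorant.\<close>

lemma integral_gradient_compact_support:
  fixes F :: "'a::euclidean_space \<Rightarrow> real"
  assumes der: "\<And>x. (F has_derivative (\<lambda>h. D x \<bullet> h)) (at x)" and D: "continuous_on UNIV D"
    and supp: "compact S" "\<And>x. x \<notin> S \<Longrightarrow> F x = 0"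
  shows "integral\<^sup>L lebesgue (\<lambda>x. D x \<bullet> b) = 0"
proof -
  have F: "continuous_on UNIV F"
    using der by (intro has_derivative_continuous_on) (auto intro: has_derivative_at_withinI)
  have D0: "D x = 0" if "x \<notin> S" for x
  proof (rule gradient_unique[OF der])
    show "(F has_derivative (\<lambda>h. 0 \<bullet> h)) (at x)"
      using has_derivative_zero_locally[of "- S" x F] supp that
      by (simp add: compact_imp_closed open_Compl)
  qed
  obtain M where M: "0 \<le> M" "\<And>x. norm (D x) \<le> M"
  proof -
    have "compact (D ` S)" by (intro compact_continuous_image continuous_on_subset[OF D] supp) auto
    then obtain M where M: "\<And>x. x \<in> S \<Longrightarrow> norm (D x) \<le> M"
      using compact_imp_bounded[of "D ` S"] by (auto simp: bounded_iff)
    have "norm (D x) \<le> max 0 M" for x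
      using M[of x] D0[of x] by (cases "x \<in> S") auto
    then show thesis using that[of "max 0 M"] by simp
  qed
  obtain R where R: "\<And>x. x \<in> S \<Longrightarrow> norm x \<le> R"
    using compact_imp_bounded[OF supp(1)] by (auto simp: bounded_iff)
  have lip: "\<bar>F x - F y\<bar> \<le> M * norm (x - y)" for x y
  proof -
    have "onorm (\<lambda>h. D x \<bullet> h) \<le> M" for x
    proof (rule onorm_le)
      show "norm (D x \<bullet> h) \<le> M * norm h" for h
        using Cauchy_Schwarz_ineq2[of "D x" h] mult_right_mono[OF M(2)[of x] norm_ge_zero[of h]] by simp
    qed
    then show ?thesis
      using differentiable_bound[of UNIV F "\<lambda>x h. D x \<bullet> h" M x y] der by simp
  qed
  have Fint: "integrable lborel F"
  proof -
    have "integrable lborel (\<lambda>x. indicator S x *\<^sub>R F x)"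
      by (intro borel_integrable_compact supp continuous_on_subset[OF F]) auto
    also have "(\<lambda>x. indicator S x *\<^sub>R F x) = F" using supp by (auto simp: indicator_def fun_eq_iff)
    finally show ?thesis .
  qed
  have [measurable]: "F \<in> borel_measurable borel" "D \<in> borel_measurable borel"
    using F D by (auto intro: borel_measurable_continuous_onI)
  have shift: "integral\<^sup>L lborel (\<lambda>x. F (c + x)) = integral\<^sup>L lborel F"
    "integrable lborel (\<lambda>x. F (c + x))" for c
  proof -
    have "integral\<^sup>L (distr lborel borel ((+) c)) F = integral\<^sup>L lborel (\<lambda>x. F (c + x))"
      by (rule integral_distr) auto
    then show "integral\<^sup>L lborel (\<lambda>x. F (c + x)) = integral\<^sup>L lborel F" by (simp add: lborel_distr_plus)
    have "integrable (distr lborel borel ((+) c)) F" using Fint by (simp add: lborel_distr_plus)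
    then show "integrable lborel (\<lambda>x. F (c + x))" by (subst (asm) integrable_distr_eq) auto
  qed
  define t where "t n = inverse (real (Suc n))" for n
  have t: "0 < t n" "t n \<le> 1" for n by (auto simp: t_def field_simps)
  have "(\<lambda>n. integral\<^sup>L lborel (\<lambda>x. (F (t n *\<^sub>R b + x) - F x) / t n)) \<longlonglongrightarrow> integral\<^sup>L lborel (\<lambda>x. D x \<bullet> b)"
  \<comment> \<open>The support lies in a ball of radius \<open>R\<close>; since
    \<open>t n \<le> 1\<close>, all its shifts stay in the ball of radius
    \<open>R + norm b\<close>.\<close>
  proof (rule integral_dominated_convergence[where w = "\<lambda>x. indicator (cball 0 (R + norm b)) x *\<^sub>R (M * norm b)"])
    show "integrable lborel (\<lambda>x. indicator (cball 0 (R + norm b)) x *\<^sub>R (M * norm b) :: real)"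
      by (intro borel_integrable_compact) auto
    show "AE x in lborel. norm ((F (t n *\<^sub>R b + x) - F x) / t n) \<le> indicator (cball 0 (R + norm b)) x *\<^sub>R (M * norm b)" for n
    proof (rule AE_I2)
      fix x :: 'a
      show "norm ((F (t n *\<^sub>R b + x) - F x) / t n) \<le> indicator (cball 0 (R + norm b)) x *\<^sub>R (M * norm b)"
      proof (cases "x \<in> cball 0 (R + norm b)")
        case True
        have "\<bar>F (t n *\<^sub>R b + x) - F x\<bar> \<le> M * (t n * norm b)"
          using lip[of "t n *\<^sub>R b + x" x] t[of n] by simp
        then show ?thesis using True t[of n] by (simp add: divide_le_eq algebra_simps)
      next
        case False
        then have nx: "R + norm b < norm x" by simp
        have "norm x \<le> norm (t n *\<^sub>R b + x) + norm (t n *\<^sub>R b)"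
          using norm_triangle_ineq4[of "t n *\<^sub>R b + x" "t n *\<^sub>R b"] by simp
        moreover have "norm (t n *\<^sub>R b) \<le> 1 * norm b" unfolding norm_scaleR using t[of n] by (intro mult_right_mono) auto
        ultimately have "R < norm (t n *\<^sub>R b + x)" "R < norm x" using nx norm_ge_zero[of b] by linarith+
        then have "t n *\<^sub>R b + x \<notin> S" "x \<notin> S" using R by (auto simp: not_le[symmetric])
        then show ?thesis using supp False by simp
      qed
    qed
    show "AE x in lborel. (\<lambda>n. (F (t n *\<^sub>R b + x) - F x) / t n) \<longlonglongrightarrow> D x \<bullet> b"
    proof (rule AE_I2)
      fix x :: 'a
      have "((\<lambda>s. x + s *\<^sub>R b) has_derivative (\<lambda>s. s *\<^sub>R b)) (at 0)"
        by (auto intro!: derivative_eq_intros)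
      from has_derivative_compose[OF this, of F "\<lambda>h. D x \<bullet> h"]
      have "((\<lambda>s. F (x + s *\<^sub>R b)) has_derivative (\<lambda>s. D x \<bullet> (s *\<^sub>R b))) (at 0)"
        using der[of x] by simp
      then have "((\<lambda>s. F (x + s *\<^sub>R b)) has_real_derivative D x \<bullet> b) (at 0)"
        unfolding has_field_derivative_def by (rule has_derivative_eq_rhs) (auto simp: fun_eq_iff)
      then have "((\<lambda>s. (F (x + s *\<^sub>R b) - F x) / s) \<longlongrightarrow> D x \<bullet> b) (at 0)"
        by (simp add: has_field_derivative_iff)
      moreover have "filterlim t (at 0) sequentially"
        using t LIMSEQ_inverse_real_of_nat unfolding t_def[abs_def] filterlim_at
        by (auto intro!: always_eventually)
      ultimately have "(\<lambda>n. (F (x + t n *\<^sub>R b) - F x) / t n) \<longlonglongrightarrow> D x \<bullet> b"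
        by (rule filterlim_compose)
      then show "(\<lambda>n. (F (t n *\<^sub>R b + x) - F x) / t n) \<longlonglongrightarrow> D x \<bullet> b" by (simp add: add.commute)
    qed
  qed auto
  moreover have "integral\<^sup>L lborel (\<lambda>x. (F (t n *\<^sub>R b + x) - F x) / t n) = 0" for n
    using shift Fint by simp
  ultimately have "integral\<^sup>L lborel (\<lambda>x. D x \<bullet> b) = 0" by (simp only: LIMSEQ_const_iff)
  then show ?thesis by (subst integral_completion) auto
qed

text \<open>The product of \<open>u\<close> with a test function, extended by 0, is continuously
  differentiable with compact support, so its gradient has integral 0; the product rule then gives
  the weak identity.\<close>

lemma C1_imp_weak_gradient:
  fixes u :: "'a::euclidean_space \<Rightarrow> real"
  assumes U: "open U" and der: "\<And>x. x \<in> U \<Longrightarrow> (u has_derivative (\<lambda>h. G x \<bullet> h)) (at x)"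
    and G: "continuous_on U G"
  shows "weak_gradient U u G"
  unfolding weak_gradient_def
proof (intro conjI allI impI ballI)
  have u: "continuous_on U u"
    using der by (intro has_derivative_continuous_on) (auto intro: has_derivative_at_withinI)
  have Us: "U \<in> sets lebesgue" using U by auto
  show "u \<in> borel_measurable (lebesgue_on U)" "G \<in> borel_measurable (lebesgue_on U)"
    using u G Us by (auto intro: continuous_imp_measurable_on_sets_lebesgue)
  fix K assume K: "compact K \<and> K \<subseteq> U"
  show "integrable (lebesgue_on K) u" "integrable (lebesgue_on K) (\<lambda>x. G x \<bullet> b)" for b
    using K u G by (auto intro!: integrable_lebesgue_on_compact continuous_intros intro: continuous_on_subset)
next
  fix phi Dphi and b :: 'a
  assume test: "c1_test U phi Dphi"
  have u: "continuous_on U u"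
    using der by (intro has_derivative_continuous_on) (auto intro: has_derivative_at_withinI)
  have Us: "U \<in> sets lebesgue" using U by auto
  define K where "K = closure {x. phi x \<noteq> 0}"
  have K: "compact K" "K \<subseteq> U" "closed K" using test by (auto simp: c1_test_def K_def)
  have phi: "\<And>x. (phi has_derivative (\<lambda>h. Dphi x \<bullet> h)) (at x)" "continuous_on UNIV Dphi"
    using test by (auto simp: c1_test_def)
  have phic: "continuous_on UNIV phi"
    using phi by (intro has_derivative_continuous_on) (auto intro: has_derivative_at_withinI)
  have phi0: "phi x = 0" if "x \<notin> K" for x
    using that closure_subset by (force simp: K_def)
  have Dphi0: "Dphi x = 0" if "x \<notin> K" for x
  proof (rule gradient_unique[OF phi(1)])
    show "(phi has_derivative (\<lambda>h. 0 \<bullet> h)) (at x)"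
      using has_derivative_zero_locally[of "- K" x phi] phi0 K that by (simp add: open_Compl)
  qed
  define F where "F x = (if x \<in> U then u x * phi x else 0)" for x
  define D where "D x = (if x \<in> U then u x *\<^sub>R Dphi x + phi x *\<^sub>R G x else 0)" for x
  \<comment> \<open>On \<open>U\<close> the product rule applies, off the support of
    \<open>phi\<close> everything vanishes, and these two open sets cover the space.\<close>
  have cover: "UNIV = U \<union> - K" using K by auto
  have "(F has_derivative (\<lambda>h. D x \<bullet> h)) (at x)" for x
  proof (cases "x \<in> U")
    case True
    have "((\<lambda>x. u x * phi x) has_derivative (\<lambda>h. D x \<bullet> h)) (at x)"
      using True by (auto intro!: derivative_eq_intros der phi simp: D_def inner_add_left algebra_simps)
    then show ?thesis
      by (rule has_derivative_transform_within_open[OF _ U True]) (simp add: F_def)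
  next
    case False
    then have "x \<in> - K" using K by auto
    then show ?thesis using has_derivative_zero_locally[of "- K" x F] K phi0 False
      by (simp add: open_Compl F_def D_def)
  qed
  moreover have "continuous_on UNIV D"
    unfolding cover
  proof (rule continuous_on_open_Un)
    have "continuous_on U (\<lambda>x. u x *\<^sub>R Dphi x + phi x *\<^sub>R G x)"
      by (intro continuous_intros u G continuous_on_subset[OF phi(2)] continuous_on_subset[OF phic]) auto
    then show "continuous_on U D" by (rule continuous_on_eq) (simp add: D_def)
    show "continuous_on (- K) D"
      by (rule continuous_on_eq[of _ "\<lambda>_. 0"]) (auto simp: D_def phi0 Dphi0)
  qed (use U K in auto)
  ultimately have "integral\<^sup>L lebesgue (\<lambda>x. D x \<bullet> b) = 0"
    by (rule integral_gradient_compact_support[OF _ _ K(1)]) (simp add: F_def phi0)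
  moreover have "(\<lambda>x. D x \<bullet> b) = (\<lambda>x. indicator U x *\<^sub>R (u x * (Dphi x \<bullet> b) + (G x \<bullet> b) * phi x))"
    by (auto simp: D_def fun_eq_iff inner_add_left)
  ultimately have "integral\<^sup>L (lebesgue_on U) (\<lambda>x. u x * (Dphi x \<bullet> b) + (G x \<bullet> b) * phi x) = 0"
    using Us by (subst integral_restrict_space) auto
  moreover have "integrable (lebesgue_on U) (\<lambda>x. u x * (Dphi x \<bullet> b))"
  proof (rule integrable_lebesgue_on_compact_support[OF K(1,2) Us])
    show "continuous_on K (\<lambda>x. u x * (Dphi x \<bullet> b))"
      using continuous_on_subset[OF phi(2), of K] continuous_on_subset[OF u K(2)]
      by (intro continuous_intros) auto
  qed (simp add: Dphi0)
  moreover have "integrable (lebesgue_on U) (\<lambda>x. (G x \<bullet> b) * phi x)"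
  proof (rule integrable_lebesgue_on_compact_support[OF K(1,2) Us])
    show "continuous_on K (\<lambda>x. (G x \<bullet> b) * phi x)"
      using continuous_on_subset[OF phic, of K] continuous_on_subset[OF G K(2)]
      by (intro continuous_intros) auto
  qed (simp add: phi0)
  ultimately show "integral\<^sup>L (lebesgue_on U) (\<lambda>x. u x * (Dphi x \<bullet> b)) = - integral\<^sup>L (lebesgue_on U) (\<lambda>x. (G x \<bullet> b) * phi x)"
    by simp
qed

section \<open>Radial fields and the divergence identity\<close>

lemma has_derivative_radial:
  fixes x :: "'a::euclidean_space"
  assumes "x \<noteq> 0" "(k has_real_derivative d) (at (norm x))"
  shows "((\<lambda>y. k (norm y)) has_derivative (\<lambda>h. ((d / norm x) *\<^sub>R x) \<bullet> h)) (at x)"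
proof -
  have "((\<lambda>y. k (norm y)) has_derivative (\<lambda>h. d * (h \<bullet> sgn x))) (at x)"
    using has_derivative_compose[OF has_derivative_norm[OF assms(1)], of k "(*) d"] assms(2)
    by (simp add: has_field_derivative_def)
  then show ?thesis
    by (rule has_derivative_eq_rhs) (auto simp: fun_eq_iff sgn_div_norm inner_commute divide_inverse)
qed

lemma integrable_bounded_mult:
  fixes phi c :: "'a \<Rightarrow> real"
  assumes "integrable M phi" "c \<in> borel_measurable M" "\<And>x. x \<in> space M \<Longrightarrow> \<bar>c x\<bar> \<le> B"
  shows "integrable M (\<lambda>x. c x * phi x)"
proof (rule Bochner_Integration.integrable_bound)
  show "integrable M (\<lambda>x. B * phi x)" using assms(1) by simp
  show "(\<lambda>x. c x * phi x) \<in> borel_measurable M" using assms(1,2) by measurable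
  show "AE x in M. norm (c x * phi x) \<le> norm (B * phi x)"
    using assms(3) by (intro AE_I2) (force simp: abs_mult intro: mult_right_mono)
qed

text \<open>The radial fields \<open>x \<mapsto> K (norm x) x\<close> have divergence \<open>J r * r\<^sup>2 + N * K r\<close>, where \<open>K' r = J r * r\<close>.\<close>
lemma weak_gradient_radial_field:
  fixes phi :: "'a::euclidean_space \<Rightarrow> real" and K J :: "real \<Rightarrow> real"
  assumes wg: "weak_gradient (ball 0 1) phi Phi"
    and phi: "integrable (lebesgue_on (ball 0 1)) phi"
    and Phi: "\<And>b. b \<in> Basis \<Longrightarrow> integrable (lebesgue_on (ball 0 1)) (\<lambda>x. Phi x \<bullet> b)"
    and Z: "compact Z" "Z \<subseteq> {0<..<1}" "\<And>r. r \<notin> Z \<Longrightarrow> K r = 0" "\<And>r. r \<notin> Z \<Longrightarrow> J r = 0"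
    and K: "\<And>r. (K has_real_derivative J r * r) (at r)" and J: "continuous_on UNIV J"
  shows "integral\<^sup>L (lebesgue_on (ball 0 1)) (\<lambda>x. (J (norm x) * (norm x)\<^sup>2 + DIM('a) * K (norm x)) * phi x)
       = - integral\<^sup>L (lebesgue_on (ball 0 1)) (\<lambda>x. K (norm x) * (x \<bullet> Phi x))"
proof -
  let ?L = "lebesgue_on (ball (0::'a) 1)"
  have Kc: "continuous_on UNIV K"
    using K by (intro DERIV_continuous_on) (auto intro: has_field_derivative_at_within)
  have Kn: "continuous_on UNIV (\<lambda>x::'a. K (norm x))" and Jn: "continuous_on UNIV (\<lambda>x::'a. J (norm x))"
    by (auto intro!: continuous_on_compose2[OF Kc] continuous_on_compose2[OF J] continuous_intros)
  define S where "S = {x::'a. norm x \<in> Z}"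
  have clS: "closed S"
  proof -
    have "closed (norm -` Z :: 'a set)"
      using Z(1) by (intro closed_vimage) (auto intro: compact_imp_closed continuous_intros)
    then show ?thesis by (simp add: S_def vimage_def)
  qed
  have "bounded S" using Z(2) by (auto simp: S_def bounded_iff intro!: exI[of _ 1] dest!: subsetD)
  then have S: "compact S" using clS by (simp add: compact_eq_bounded_closed)
  have SB: "S \<subseteq> ball 0 1" using Z(2) by (auto simp: S_def dest!: subsetD)
  have S0: "0 \<notin> S" using Z(2) by (auto simp: S_def)
  \<comment> \<open>The norm is not differentiable at the origin, but the coefficient vanishes in a
    neighbourhood of it.\<close>
  have Kder: "((\<lambda>y. K (norm y)) has_derivative (\<lambda>h. (J (norm x) *\<^sub>R x) \<bullet> h)) (at x)" for x :: 'a
  proof (cases "x = 0")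
    case False
    then show ?thesis using has_derivative_radial[OF False K[of "norm x"]] by simp
  next
    case True
    have "((\<lambda>y::'a. K (norm y)) has_derivative (\<lambda>_. 0)) (at x)"
      by (rule has_derivative_zero_locally[of "- S"]) (use clS S0 True Z in \<open>auto simp: S_def\<close>)
    then show ?thesis using True by simp
  qed
  have meas: "c \<in> borel_measurable ?L" if "continuous_on UNIV c" for c :: "'a \<Rightarrow> real"
    by (rule continuous_imp_measurable_on_sets_lebesgue) (use that in \<open>auto intro: continuous_on_subset\<close>)
  have bdd: "\<exists>B. \<forall>x\<in>ball 0 1. \<bar>c x\<bar> \<le> B" if "continuous_on UNIV c" for c :: "'a \<Rightarrow> real"
  proof -
    have "bounded (c ` cball 0 1)"
      by (intro compact_imp_bounded compact_continuous_image continuous_on_subset[OF that]) auto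
    then obtain B where "\<forall>y\<in>c ` cball 0 1. norm y \<le> B" unfolding bounded_iff by blast
    then show ?thesis by (intro exI[of _ B]) auto
  qed
  have int: "integrable ?L (\<lambda>x. c x * q x)" if cq: "continuous_on UNIV c" "integrable ?L q" for c q :: "'a \<Rightarrow> real"
  proof -
    obtain B where "\<And>x. x \<in> ball 0 1 \<Longrightarrow> \<bar>c x\<bar> \<le> B" using bdd[OF cq(1)] by blast
    then show ?thesis using integrable_bounded_mult[OF cq(2) meas[OF cq(1)], of B] by simp
  qed
  have comp: "integral\<^sup>L ?L (\<lambda>x. (J (norm x) * (x \<bullet> b)\<^sup>2 + K (norm x)) * phi x)
      = - integral\<^sup>L ?L (\<lambda>x. (K (norm x) * (x \<bullet> b)) * (Phi x \<bullet> b))" if b: "b \<in> Basis" for b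
  proof -
    \<comment> \<open>\<open>t\<close> is the \<open>b\<close>-th component of the field, an
      admissible scalar test function; summing its derivatives in direction \<open>b\<close> over
      the basis yields the divergence.\<close>
    define t where "t x = K (norm x) * (x \<bullet> b)" for x
    define Dt where "Dt x = (J (norm x) * (x \<bullet> b)) *\<^sub>R x + K (norm x) *\<^sub>R b" for x
    have "c1_test (ball 0 1) t Dt"
      unfolding c1_test_def
    proof (intro conjI allI)
      show "(t has_derivative (\<lambda>h. Dt x \<bullet> h)) (at x)" for x
        unfolding t_def[abs_def] Dt_def
        by (rule has_derivative_eq_rhs, rule has_derivative_mult[OF Kder])
          (auto intro!: derivative_eq_intros simp: fun_eq_iff inner_add_left inner_commute algebra_simps)
      show "continuous_on UNIV Dt" unfolding Dt_def[abs_def] by (intro continuous_intros Jn Kn)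
      have "{x. t x \<noteq> 0} \<subseteq> S" using Z by (auto simp: t_def S_def)
      then have cl: "closure {x. t x \<noteq> 0} \<subseteq> S" using clS by (rule closure_minimal)
      then show "compact (closure {x. t x \<noteq> 0})"
        using S by (meson bounded_subset closed_closure compact_eq_bounded_closed)
      show "closure {x. t x \<noteq> 0} \<subseteq> ball 0 1" using cl SB by auto
    qed
    then have "integral\<^sup>L ?L (\<lambda>x. phi x * (Dt x \<bullet> b)) = - integral\<^sup>L ?L (\<lambda>x. (Phi x \<bullet> b) * t x)"
      using wg b by (simp add: weak_gradient_def)
    moreover have "Dt x \<bullet> b = J (norm x) * (x \<bullet> b)\<^sup>2 + K (norm x)" for x
      using b by (simp add: Dt_def inner_add_left power2_eq_square mult.assoc)
    ultimately show ?thesis by (simp add: t_def mult.commute)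
  qed
  have "integral\<^sup>L ?L (\<lambda>x. (J (norm x) * (norm x)\<^sup>2 + DIM('a) * K (norm x)) * phi x)
      = integral\<^sup>L ?L (\<lambda>x. \<Sum>b\<in>Basis. (J (norm x) * (x \<bullet> b)\<^sup>2 + K (norm x)) * phi x)"
  proof (intro Bochner_Integration.integral_cong refl)
    fix x :: 'a
    have "(norm x)\<^sup>2 = (\<Sum>b\<in>Basis. (x \<bullet> b)\<^sup>2)"
      unfolding power2_norm_eq_inner by (subst euclidean_inner) (simp add: power2_eq_square)
    then show "(J (norm x) * (norm x)\<^sup>2 + DIM('a) * K (norm x)) * phi x
        = (\<Sum>b\<in>Basis. (J (norm x) * (x \<bullet> b)\<^sup>2 + K (norm x)) * phi x)"
      by (simp add: sum.distrib sum_distrib_left sum_distrib_right[symmetric])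
  qed
  also have "\<dots> = (\<Sum>b\<in>Basis. integral\<^sup>L ?L (\<lambda>x. (J (norm x) * (x \<bullet> b)\<^sup>2 + K (norm x)) * phi x))"
    by (intro Bochner_Integration.integral_sum int phi continuous_intros Jn Kn)
  also have "\<dots> = - (\<Sum>b\<in>Basis. integral\<^sup>L ?L (\<lambda>x. (K (norm x) * (x \<bullet> b)) * (Phi x \<bullet> b)))"
    by (simp add: comp sum_negf)
  also have "(\<Sum>b\<in>Basis. integral\<^sup>L ?L (\<lambda>x. (K (norm x) * (x \<bullet> b)) * (Phi x \<bullet> b)))
      = integral\<^sup>L ?L (\<lambda>x. \<Sum>b\<in>Basis. (K (norm x) * (x \<bullet> b)) * (Phi x \<bullet> b))"
    by (intro Bochner_Integration.integral_sum[symmetric] int Phi continuous_intros Kn)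
  also have "\<dots> = integral\<^sup>L ?L (\<lambda>x. K (norm x) * (x \<bullet> Phi x))"
    by (simp add: euclidean_inner[of _ "Phi _"] sum_distrib_left mult.assoc)
  finally show ?thesis .
qed

section \<open>Cutting off small flux\<close>

text \<open>A continuously differentiable substitute for \<open>t\<close> on the half-line: it
  vanishes for \<open>t \<le> e\<close>, lies between 0 and \<open>t\<close>, has slope between 0
  and 1, and tends to \<open>t\<close> as \<open>e\<close> decreases to 0.\<close>

definition cutoff :: "real \<Rightarrow> real \<Rightarrow> real" where
  "cutoff e t = (if t \<le> e then 0 else (t - e)\<^sup>2 / t)"

definition cutoff' :: "real \<Rightarrow> real \<Rightarrow> real" where
  "cutoff' e t = (if t \<le> e then 0 else 1 - (e / t)\<^sup>2)"

lemma cutoff_has_derivative: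
  assumes e: "0 < e"
  shows "(cutoff e has_real_derivative cutoff' e t) (at t)"
proof -
  consider "t < e" | "t > e" | "t = e" by linarith
  then show ?thesis
  proof cases
    case 1
    have "((\<lambda>_. 0) has_real_derivative cutoff' e t) (at t)" using 1 by (simp add: cutoff'_def)
    then show ?thesis
      by (rule has_field_derivative_transform_within_open[of _ _ _ "{..<e}"]) (use 1 in \<open>auto simp: cutoff_def\<close>)
  next
    case 2
    have "((\<lambda>t. (t - e)\<^sup>2 / t) has_real_derivative cutoff' e t) (at t)"
      using 2 e by (auto intro!: derivative_eq_intros simp: cutoff'_def power2_eq_square field_simps)
    then show ?thesis
      by (rule has_field_derivative_transform_within_open[of _ _ _ "{e<..}"]) (use 2 in \<open>auto simp: cutoff_def\<close>)
  next
    case 3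
    have "((\<lambda>s. (cutoff e s - cutoff e e) / (s - e)) \<longlongrightarrow> 0) (at e)"
    proof (rule Lim_null_comparison)
      show "\<forall>\<^sub>F s in at e. norm ((cutoff e s - cutoff e e) / (s - e)) \<le> \<bar>s - e\<bar> / e"
      proof (rule always_eventually, rule allI)
        fix s
        show "norm ((cutoff e s - cutoff e e) / (s - e)) \<le> \<bar>s - e\<bar> / e"
        proof (cases "s \<le> e")
          case False
          then have "norm ((cutoff e s - cutoff e e) / (s - e)) = (s - e) / s"
            using e by (simp add: cutoff_def power2_eq_square)
          also have "\<dots> \<le> (s - e) / e" using False e by (intro divide_left_mono) auto
          finally show ?thesis using False by simp
        qed (use e in \<open>simp add: cutoff_def\<close>)
      qed
      show "((\<lambda>s. \<bar>s - e\<bar> / e) \<longlongrightarrow> 0) (at e)"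
        using e by (auto intro!: tendsto_eq_intros)
    qed
    then show ?thesis using 3 by (simp add: has_field_derivative_iff cutoff'_def)
  qed
qed

lemma continuous_on_cutoff':
  assumes e: "0 < e"
  shows "continuous_on UNIV (cutoff' e)"
proof -
  have "cutoff' e = (\<lambda>t. 1 - (e / max e t)\<^sup>2)"
    using e by (auto simp: cutoff'_def fun_eq_iff max_def)
  then show ?thesis using e by (auto intro!: continuous_intros)
qed

lemma cutoff'_bounds: "0 < e \<Longrightarrow> 0 \<le> cutoff' e t \<and> cutoff' e t \<le> 1"
  by (auto simp: cutoff'_def power_le_one)

lemma cutoff_bounds:
  assumes "0 < e" "0 \<le> t"
  shows "0 \<le> cutoff e t \<and> cutoff e t \<le> t"
proof (cases "t \<le> e")
  case False
  then have "(t - e)\<^sup>2 \<le> t\<^sup>2" using assms by (intro power_mono) auto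
  then show ?thesis using False assms by (simp add: cutoff_def divide_le_eq power2_eq_square)
qed (use assms in \<open>simp add: cutoff_def\<close>)

lemma cutoff_tendsto:
  assumes "0 < t" "e \<longlonglongrightarrow> 0"
  shows "(\<lambda>n. cutoff (e n) t) \<longlonglongrightarrow> t" "(\<lambda>n. cutoff' (e n) t) \<longlonglongrightarrow> 1"
proof -
  have ev: "\<forall>\<^sub>F n in sequentially. e n < t" using assms by (intro order_tendstoD) auto
  have "(\<lambda>n. (t - e n)\<^sup>2 / t) \<longlonglongrightarrow> t"
    using assms by (auto intro!: tendsto_eq_intros simp: power2_eq_square)
  then show "(\<lambda>n. cutoff (e n) t) \<longlonglongrightarrow> t"
    by (rule Lim_transform_eventually) (use ev in \<open>eventually_elim, simp add: cutoff_def\<close>)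
  have "(\<lambda>n. 1 - (e n / t)\<^sup>2) \<longlonglongrightarrow> 1"
    using assms by (auto intro!: tendsto_eq_intros)
  then show "(\<lambda>n. cutoff' (e n) t) \<longlonglongrightarrow> 1"
    by (rule Lim_transform_eventually) (use ev in \<open>eventually_elim, simp add: cutoff'_def\<close>)
qed

text \<open>The field \<open>x / norm x ^ N\<close> is divergence free off the origin, so the
  divergence of the cut-off flux field involves only the derivative of
  \<open>cutoff e (W r)\<close>, and the factors \<open>r ^ m\<close> cancel. Since \<open>W\<close>
  vanishes at 0 and at 1, the field has compact support in the punctured open ball. This is where
  the Neumann condition \<open>W 1 = 0\<close> enters: \<open>phi\<close> carries no boundary
  condition.\<close>

lemma radial_cutoff_identity:
  fixes phi :: "'a::euclidean_space \<Rightarrow> real" and W h :: "real \<Rightarrow> real"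
  assumes wg: "weak_gradient (ball 0 1) phi Phi"
    and phi: "integrable (lebesgue_on (ball 0 1)) phi"
    and Phi: "\<And>b. b \<in> Basis \<Longrightarrow> integrable (lebesgue_on (ball 0 1)) (\<lambda>x. Phi x \<bullet> b)"
    and m: "DIM('a) = Suc m"
    and W_der: "\<And>r. 0 < r \<Longrightarrow> r < 1 \<Longrightarrow> (W has_real_derivative - (r ^ m * h r)) (at r)"
    and h: "continuous_on {0..1} h" and W: "continuous_on {0..1} W" "W 0 = 0" "W 1 = 0"
    and e: "0 < e"
  shows "integral\<^sup>L (lebesgue_on (ball 0 1)) (\<lambda>x. cutoff' e (W (norm x)) * h (norm x) * phi x)
       = integral\<^sup>L (lebesgue_on (ball 0 1)) (\<lambda>x. cutoff e (W (norm x)) / norm x ^ DIM('a) * (x \<bullet> Phi x))"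
proof -
  let ?L = "lebesgue_on (ball (0::'a) 1)" and ?N = "DIM('a)"
  define Z where "Z = {r\<in>{0..1}. e \<le> W r}"
  have "closed Z"
  proof -
    have "closed ({0..1} \<inter> W -` {e..})" by (intro continuous_closed_preimage W) auto
    moreover have "{0..1} \<inter> W -` {e..} = Z" by (auto simp: Z_def)
    ultimately show ?thesis by simp
  qed
  moreover have "bounded Z" by (rule bounded_subset[of "{0..1}"]) (auto simp: Z_def)
  ultimately have Z: "compact Z" by (simp add: compact_eq_bounded_closed)
  have Zsub: "Z \<subseteq> {0<..<1}"
  proof
    fix r assume "r \<in> Z"
    then have "0 \<le> r" "r \<le> 1" "r \<noteq> 0" "r \<noteq> 1" using W e by (auto simp: Z_def)
    then show "r \<in> {0<..<1}" by simp
  qed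
  define K where "K r = (if r \<in> {0<..<1} then cutoff e (W r) / r ^ ?N else 0)" for r
  \<comment> \<open>\<open>J\<close> is the derivative of \<open>K\<close> divided by
    \<open>r\<close>, the form that the divergence identity requires.\<close>
  define J where "J r = (if r \<in> {0<..<1}
      then (cutoff' e (W r) * - (r ^ m * h r) / r ^ ?N - ?N * cutoff e (W r) / r ^ Suc ?N) / r else 0)" for r
  have K0: "K r = 0" and J0: "J r = 0" if "r \<notin> Z" for r
    using that by (auto simp: K_def J_def Z_def cutoff_def cutoff'_def)
  have cover: "UNIV = {0<..<1} \<union> - Z" using Zsub by auto
  have KD: "(K has_real_derivative J r * r) (at r)" for r
  proof (cases "r \<in> {0<..<1}")
    case True
    have "((\<lambda>r. cutoff e (W r)) has_real_derivative cutoff' e (W r) * - (r ^ m * h r)) (at r)"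
      using DERIV_chain2[OF cutoff_has_derivative[OF e] W_der[of r]] True by simp
    then have "((\<lambda>r. cutoff e (W r) / r ^ ?N) has_real_derivative
        ((cutoff' e (W r) * - (r ^ m * h r)) * r ^ ?N - cutoff e (W r) * (?N * r ^ (?N - 1))) / (r ^ ?N * r ^ ?N)) (at r)"
      using True by (intro DERIV_divide DERIV_pow) auto
    moreover have "((cutoff' e (W r) * - (r ^ m * h r)) * r ^ ?N - cutoff e (W r) * (?N * r ^ (?N - 1))) / (r ^ ?N * r ^ ?N) = J r * r"
      using True by (simp add: J_def m field_simps)
    ultimately have "((\<lambda>r. cutoff e (W r) / r ^ ?N) has_real_derivative J r * r) (at r)" by simp
    then show ?thesis
      by (rule has_field_derivative_transform_within_open[OF _ _ True]) (auto simp: K_def)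
  next
    case False
    then have r: "r \<in> - Z" using Zsub by auto
    have "((\<lambda>_. 0) has_real_derivative J r * r) (at r)" using J0 r by simp
    then show ?thesis
      by (rule has_field_derivative_transform_within_open[OF _ _ r]) (use \<open>closed Z\<close> K0 in auto)
  qed
  have Wo: "continuous_on {0<..<1} W" "continuous_on {0<..<1} h"
    using W h by (auto intro: continuous_on_subset)
  have cut: "continuous_on UNIV (cutoff e)"
    using cutoff_has_derivative[OF e] by (intro DERIV_continuous_on) (auto intro: has_field_derivative_at_within)
  have Jc: "continuous_on UNIV J"
    unfolding cover
  proof (rule continuous_on_open_Un)
    have "continuous_on {0<..<1} (\<lambda>r. (cutoff' e (W r) * - (r ^ m * h r) / r ^ ?N - ?N * cutoff e (W r) / r ^ Suc ?N) / r)"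
      by (intro continuous_intros Wo continuous_on_compose2[OF cut] continuous_on_compose2[OF continuous_on_cutoff'[OF e]]) auto
    then show "continuous_on {0<..<1} J" by (rule continuous_on_eq) (auto simp: J_def)
    show "continuous_on (- Z) J" by (rule continuous_on_eq[of _ "\<lambda>_. 0"]) (auto simp: J0)
  qed (use \<open>closed Z\<close> in auto)
  have "integral\<^sup>L ?L (\<lambda>x. (J (norm x) * (norm x)\<^sup>2 + ?N * K (norm x)) * phi x)
      = - integral\<^sup>L ?L (\<lambda>x. K (norm x) * (x \<bullet> Phi x))"
    by (rule weak_gradient_radial_field[OF wg phi Phi Z Zsub K0 J0 KD Jc])
  also have "integral\<^sup>L ?L (\<lambda>x. (J (norm x) * (norm x)\<^sup>2 + ?N * K (norm x)) * phi x)
      = integral\<^sup>L ?L (\<lambda>x. - (cutoff' e (W (norm x)) * h (norm x) * phi x))"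
  proof (intro Bochner_Integration.integral_cong refl)
    fix x :: 'a assume x: "x \<in> space ?L"
    have "J r * r\<^sup>2 + ?N * K r = - (cutoff' e (W r) * h r)" if r: "0 \<le> r" "r < 1" for r
    proof (cases "r = 0")
      case False
      then have "r \<in> {0<..<1}" using r by simp
      then show ?thesis by (simp add: J_def K_def m field_simps power2_eq_square)
    qed (use e W in \<open>simp add: J_def K_def cutoff'_def\<close>)
    from this[of "norm x"] x
    show "(J (norm x) * (norm x)\<^sup>2 + ?N * K (norm x)) * phi x = - (cutoff' e (W (norm x)) * h (norm x) * phi x)"
      by simp
  qed
  also have "integral\<^sup>L ?L (\<lambda>x. K (norm x) * (x \<bullet> Phi x))
      = integral\<^sup>L ?L (\<lambda>x. cutoff e (W (norm x)) / norm x ^ ?N * (x \<bullet> Phi x))"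
    by (intro Bochner_Integration.integral_cong refl) (auto simp: K_def)
  finally show ?thesis by simp
qed

text \<open>Let \<open>e\<close> tend to 0 in the cutoff identity. The bound
  \<open>W r \<le> C * r * r ^ m\<close> cancels the singularity at the origin and gives the
  majorant \<open>C * norm (Phi x)\<close>. At interior radii where \<open>W\<close> vanishes,
  \<open>cutoff'\<close> stays 0 instead of tending to 1, but there \<open>h\<close> vanishes
  too.\<close>

lemma flux_weak_form:
  fixes phi :: "'a::euclidean_space \<Rightarrow> real" and W h :: "real \<Rightarrow> real"
  assumes wg: "weak_gradient (ball 0 1) phi Phi"
    and phi: "integrable (lebesgue_on (ball 0 1)) phi"
    and Phi: "integrable (lebesgue_on (ball 0 1)) Phi"
    and m: "DIM('a) = Suc m"
    and W_der: "\<And>r. 0 < r \<Longrightarrow> r < 1 \<Longrightarrow> (W has_real_derivative - (r ^ m * h r)) (at r)"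
    and h: "continuous_on {0..1} h" and W: "continuous_on {0..1} W" "W 1 = 0"
    and W_bd: "\<And>r. 0 \<le> r \<Longrightarrow> r \<le> 1 \<Longrightarrow> 0 \<le> W r \<and> W r \<le> C * r * r ^ m"
  shows "integral\<^sup>L (lebesgue_on (ball 0 1)) (\<lambda>x. W (norm x) / norm x ^ DIM('a) * (x \<bullet> Phi x))
       = integral\<^sup>L (lebesgue_on (ball 0 1)) (\<lambda>x. h (norm x) * phi x)"
proof -
  let ?L = "lebesgue_on (ball (0::'a) 1)" and ?N = "DIM('a)"
  have W0: "W 0 = 0" using W_bd[of 0] by simp
  define e where "e n = inverse (real (Suc n))" for n
  have e: "0 < e n" for n by (simp add: e_def)
  have e_lim: "e \<longlonglongrightarrow> 0" unfolding e_def[abs_def] by (rule LIMSEQ_inverse_real_of_nat)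
  have Phib: "integrable ?L (\<lambda>x. Phi x \<bullet> b)" for b using Phi by simp
  have [measurable]: "phi \<in> borel_measurable ?L" "Phi \<in> borel_measurable ?L"
    using phi Phi by auto
  have mc: "(\<lambda>x. q (norm x)) \<in> borel_measurable ?L" if "continuous_on {0..1} q" for q :: "real \<Rightarrow> real"
    by (rule continuous_imp_measurable_on_sets_lebesgue)
      (auto intro!: continuous_on_compose2[OF that] continuous_intros)
  have [measurable]: "(\<lambda>x. W (norm x)) \<in> borel_measurable ?L" "(\<lambda>x. h (norm x)) \<in> borel_measurable ?L"
    using mc W h by auto
  have [measurable]: "(\<lambda>x::'a. x) \<in> ?L \<rightarrow>\<^sub>M borel"
    by (rule continuous_imp_measurable_on_sets_lebesgue) auto
  have [measurable]: "cutoff (e n) \<in> borel_measurable borel" "cutoff' (e n) \<in> borel_measurable borel" for n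
  proof -
    have "continuous_on UNIV (cutoff (e n))"
      using cutoff_has_derivative[OF e] by (intro DERIV_continuous_on) (auto intro: has_field_derivative_at_within)
    then show "cutoff (e n) \<in> borel_measurable borel" by (rule borel_measurable_continuous_onI)
    show "cutoff' (e n) \<in> borel_measurable borel"
      using continuous_on_cutoff'[OF e] by (rule borel_measurable_continuous_onI)
  qed
  have nz: "AE x in ?L. x \<noteq> 0"
  proof -
    have "AE x in lebesgue. x \<noteq> (0::'a)" by (rule AE_completion[OF AE_lborel_singleton])
    then show ?thesis by (subst AE_restrict_space_iff) auto
  qed
  have sp: "AE x in ?L. x \<in> ball 0 1" by (rule AE_I2) simp
  obtain B where B: "\<And>r. 0 \<le> r \<Longrightarrow> r \<le> 1 \<Longrightarrow> \<bar>h r\<bar> \<le> B"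
  proof -
    have "bounded (h ` {0..1})" by (intro compact_imp_bounded compact_continuous_image h) auto
    then obtain B where "\<forall>y\<in>h ` {0..1}. norm y \<le> B" unfolding bounded_iff by blast
    then show thesis using that[of B] by auto
  qed
  have lim1: "(\<lambda>n. integral\<^sup>L ?L (\<lambda>x. cutoff' (e n) (W (norm x)) * h (norm x) * phi x))
      \<longlonglongrightarrow> integral\<^sup>L ?L (\<lambda>x. h (norm x) * phi x)"
  proof (rule integral_dominated_convergence[where w = "\<lambda>x. B * \<bar>phi x\<bar>"])
    show "integrable ?L (\<lambda>x. B * \<bar>phi x\<bar>)" using phi by simp
    show "AE x in ?L. norm (cutoff' (e n) (W (norm x)) * h (norm x) * phi x) \<le> B * \<bar>phi x\<bar>" for n
      using sp
    proof eventually_elim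
      case (elim x)
      have "\<bar>cutoff' (e n) (W (norm x))\<bar> * \<bar>h (norm x)\<bar> \<le> 1 * B"
        using cutoff'_bounds[OF e[of n]] B[of "norm x"] elim by (intro mult_mono) auto
      then have "\<bar>cutoff' (e n) (W (norm x))\<bar> * \<bar>h (norm x)\<bar> * \<bar>phi x\<bar> \<le> B * \<bar>phi x\<bar>"
        by (intro mult_right_mono) auto
      then show ?case by (simp add: abs_mult)
    qed
    show "AE x in ?L. (\<lambda>n. cutoff' (e n) (W (norm x)) * h (norm x) * phi x) \<longlonglongrightarrow> h (norm x) * phi x"
      using sp nz
    proof eventually_elim
      case (elim x)
      define r where "r = norm x"
      have r: "0 < r" "r < 1" using elim by (auto simp: r_def)
      show ?case
      proof (cases "W r = 0")
        case True
        \<comment> \<open>\<open>r\<close> is then an interior minimum of \<open>W \<ge> 0\<close>, so \<open>W' r = 0\<close>.\<close>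
        have "- (r ^ m * h r) = 0"
        proof (rule DERIV_local_min[OF W_der[OF r]])
          show "0 < min r (1 - r)" using r by simp
          show "\<forall>y. \<bar>r - y\<bar> < min r (1 - r) \<longrightarrow> W r \<le> W y"
            using W_bd True by (auto simp: abs_less_iff)
        qed
        then have "h r = 0" using r by simp
        then show ?thesis by (simp add: r_def)
      next
        case False
        then have "0 < W r" using W_bd[of r] r by simp
        then have "(\<lambda>n. cutoff' (e n) (W r)) \<longlonglongrightarrow> 1" using e_lim by (rule cutoff_tendsto(2))
        then have "(\<lambda>n. cutoff' (e n) (W r) * h r * phi x) \<longlonglongrightarrow> 1 * h r * phi x"
          by (intro tendsto_intros)
        then show ?thesis by (simp add: r_def)
      qed
    qed
  qed measurable
  have lim2: "(\<lambda>n. integral\<^sup>L ?L (\<lambda>x. cutoff (e n) (W (norm x)) / norm x ^ ?N * (x \<bullet> Phi x)))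
      \<longlonglongrightarrow> integral\<^sup>L ?L (\<lambda>x. W (norm x) / norm x ^ ?N * (x \<bullet> Phi x))"
  proof (rule integral_dominated_convergence[where w = "\<lambda>x. C * norm (Phi x)"])
    show "integrable ?L (\<lambda>x. C * norm (Phi x))" using Phi by simp
    show "AE x in ?L. norm (cutoff (e n) (W (norm x)) / norm x ^ ?N * (x \<bullet> Phi x)) \<le> C * norm (Phi x)" for n
      using sp nz
    proof eventually_elim
      case (elim x)
      have r: "0 < norm x" "norm x < 1" using elim by auto
      have c: "0 \<le> cutoff (e n) (W (norm x))" "cutoff (e n) (W (norm x)) \<le> W (norm x)" "W (norm x) \<le> C * norm x * norm x ^ m"
        using cutoff_bounds[OF e[of n], of "W (norm x)"] W_bd[of "norm x"] r by auto
      have "norm (cutoff (e n) (W (norm x)) / norm x ^ ?N * (x \<bullet> Phi x))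
          = cutoff (e n) (W (norm x)) / norm x ^ ?N * \<bar>x \<bullet> Phi x\<bar>"
        using c by (simp add: abs_mult)
      also have "\<dots> \<le> (C * norm x * norm x ^ m) / norm x ^ ?N * (norm x * norm (Phi x))"
        using c Cauchy_Schwarz_ineq2[of x "Phi x"] by (intro mult_mono divide_right_mono) auto
      also have "\<dots> = C * norm x * norm (Phi x)" using r by (simp add: m)
      also have "\<dots> \<le> C * norm (Phi x)"
      proof -
        \<comment> \<open>The sign of \<open>C\<close> is read off from
          \<open>0 \<le> W r \<le> C * r * r ^ m\<close>.\<close>
        have "0 \<le> C * (norm x * norm x ^ m)" using c by (simp add: mult.assoc)
        moreover have "0 < norm x * norm x ^ m" using r by simp
        ultimately have "0 \<le> C" unfolding zero_le_mult_iff by linarith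
        then show ?thesis using r by (simp add: mult_right_mono mult_left_le)
      qed
      finally show ?case .
    qed
    show "AE x in ?L. (\<lambda>n. cutoff (e n) (W (norm x)) / norm x ^ ?N * (x \<bullet> Phi x))
        \<longlonglongrightarrow> W (norm x) / norm x ^ ?N * (x \<bullet> Phi x)"
      using sp
    proof eventually_elim
      case (elim x)
      have "(\<lambda>n. cutoff (e n) (W (norm x))) \<longlonglongrightarrow> W (norm x)"
      proof (cases "W (norm x) = 0")
        case True
        then show ?thesis using e by (simp add: cutoff_def less_imp_le)
      next
        case False
        then have "0 < W (norm x)" using W_bd[of "norm x"] elim by simp
        then show ?thesis using e_lim by (rule cutoff_tendsto(1))
      qed
      then show ?case by (cases "x = 0") (auto intro!: tendsto_intros)
    qed
  qed measurable
  have "integral\<^sup>L ?L (\<lambda>x. cutoff' (e n) (W (norm x)) * h (norm x) * phi x)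
      = integral\<^sup>L ?L (\<lambda>x. cutoff (e n) (W (norm x)) / norm x ^ ?N * (x \<bullet> Phi x))" for n
    by (rule radial_cutoff_identity[OF wg phi Phib m W_der h W(1) W0 W(2) e])
  from lim1[unfolded this] show ?thesis by (rule LIMSEQ_unique[OF lim2])
qed

subsection \<open>From the profile to the weak solution\<close>

text \<open>A nonzero value would persist on a nonempty open set, which is not negligible. Almost
  everywhere statements about continuous solutions thus reduce to values at single points.\<close>

lemma AE_zero_imp_zero:
  fixes F :: "'a::euclidean_space \<Rightarrow> real"
  assumes S: "open S" and F: "continuous_on S F" and ae: "AE x in lebesgue_on S. F x = 0" and x: "x \<in> S"
  shows "F x = 0"
proof (rule ccontr)
  assume ne: "F x \<noteq> 0"
  define T where "T = S \<inter> F -` (- {0})"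
  have T: "open T" unfolding T_def using S F by (intro continuous_open_preimage) auto
  have "AE x in lebesgue. x \<in> S \<longrightarrow> F x = 0"
    using ae S by (subst (asm) AE_restrict_space_iff) auto
  then have "AE x in lebesgue. x \<notin> T" by (rule AE_mp) (auto simp: T_def)
  then have "T \<in> null_sets lebesgue"
    using T by (subst (asm) AE_iff_null_sets[symmetric]) auto
  then have "negligible T" by (simp add: negligible_iff_null_sets)
  moreover have "x \<in> T" using x ne by (simp add: T_def)
  ultimately show False using open_not_negligible[OF T] by auto
qed

text \<open>Pointwise \<open>norm (f x) \<le> 1 + norm (f x) powr p\<close>. On the ball this makes
  test functions and their gradients integrable.\<close>

lemma integrable_of_integrable_powr:
  fixes f :: "'a \<Rightarrow> 'b::{banach, second_countable_topology}"
  assumes M: "finite_measure M" and f: "f \<in> borel_measurable M" "integrable M (\<lambda>x. norm (f x) powr p)" and p: "1 \<le> p"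
  shows "integrable M f"
proof (rule Bochner_Integration.integrable_bound)
  interpret finite_measure M by (rule M)
  show "integrable M (\<lambda>x. 1 + norm (f x) powr p)" using f by simp
  show "AE x in M. norm (f x) \<le> norm (1 + norm (f x) powr p)"
  proof (rule AE_I2)
    fix x
    show "norm (f x) \<le> norm (1 + norm (f x) powr p)"
    proof (cases "norm (f x) \<le> 1")
      case False
      then have "norm (f x) powr 1 \<le> norm (f x) powr p" using p by (intro powr_mono) auto
      then show ?thesis using False by simp
    qed (simp add: add_increasing2)
  qed
qed (rule f(1))

text \<open>Away from the origin this is the chain rule; at the origin \<open>V 0 = 0\<close> gives
  a vanishing derivative, and \<open>G\<close> is continuous there because its norm is at most
  \<open>\<bar>V (norm x)\<bar>\<close>.\<close>

lemma radial_C1: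
  fixes U V :: "real \<Rightarrow> real"
  assumes U: "\<And>r. r \<in> {0..1} \<Longrightarrow> (U has_real_derivative V r) (at r within {0..1})"
    and V: "continuous_on {0..1} V" "V 0 = 0"
  defines "G \<equiv> \<lambda>x::'a::euclidean_space. (V (norm x) / norm x) *\<^sub>R x"
  shows "\<And>x. x \<in> ball 0 1 \<Longrightarrow> ((\<lambda>x. U (norm x)) has_derivative (\<lambda>h. G x \<bullet> h)) (at x)"
    and "continuous_on (ball 0 1) G"
proof -
  fix x :: 'a assume x: "x \<in> ball 0 1"
  show "((\<lambda>x. U (norm x)) has_derivative (\<lambda>h. G x \<bullet> h)) (at x)"
  proof (cases "x = 0")
    case False
    have "at (norm x) within {0..1} = at (norm x)" using x False by (intro at_within_Icc_at) auto
    then have "(U has_real_derivative V (norm x)) (at (norm x))" using U[of "norm x"] x by simp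
    then show ?thesis unfolding G_def by (rule has_derivative_radial[OF False])
  next
    case True
    have "(U has_derivative (\<lambda>_. 0)) (at 0 within {0..1})"
      using U[of 0] V(2) by (simp add: has_field_derivative_def lambda_zero)
    then have U0: "\<exists>d>0. \<forall>y\<in>{0..1}. \<bar>y\<bar> < d \<longrightarrow> \<bar>U y - U 0\<bar> \<le> e * \<bar>y\<bar>" if "0 < e" for e
      using that unfolding has_derivative_within_alt by simp
    have "((\<lambda>x::'a. U (norm x)) has_derivative (\<lambda>_. 0)) (at 0)"
      unfolding has_derivative_at_alt
    proof (intro conjI allI impI)
      fix e :: real assume "0 < e"
      from U0[OF this] obtain d where d: "0 < d" "\<And>y. y \<in> {0..1} \<Longrightarrow> \<bar>y\<bar> < d \<Longrightarrow> \<bar>U y - U 0\<bar> \<le> e * \<bar>y\<bar>" by blast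
      show "\<exists>d>0. \<forall>y::'a. norm (y - 0) < d \<longrightarrow> norm (U (norm y) - U (norm (0::'a)) - 0) \<le> e * norm (y - 0)"
        using d by (intro exI[of _ "min d 1"]) auto
    qed simp
    then show ?thesis using True by (simp add: G_def)
  qed
next
  have Vn: "continuous_on (ball 0 1) (\<lambda>x::'a. V (norm x))"
    by (rule continuous_on_compose2[OF V(1)]) (auto intro: continuous_intros)
  have "isCont G x" if x: "x \<in> ball 0 1" for x
  proof (cases "x = 0")
    case False
    have "continuous_on (ball 0 1 - {0}) G"
      unfolding G_def by (intro continuous_intros continuous_on_subset[OF Vn]) auto
    moreover have "open (ball (0::'a) 1 - {0})" by (intro open_Diff) auto
    ultimately show ?thesis using x False by (simp add: continuous_on_eq_continuous_at)
  next
    case True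
    have "isCont (\<lambda>x::'a. V (norm x)) 0"
      using Vn by (simp add: continuous_on_eq_continuous_at)
    then have "((\<lambda>x::'a. \<bar>V (norm x)\<bar>) \<longlongrightarrow> 0) (at 0)"
      using V(2) by (auto simp: isCont_def intro: tendsto_rabs_zero)
    then have "(G \<longlongrightarrow> 0) (at 0)"
      by (rule Lim_null_comparison[rotated]) (auto simp: G_def intro!: always_eventually)
    then show ?thesis using True by (simp add: isCont_def G_def)
  qed
  then show "continuous_on (ball 0 1) G" by (simp add: continuous_on_eq_continuous_at)
qed

text \<open>Inverting the power turns the slope back into the flux:
  \<open>norm (G x) powr (p - 2) *\<^sub>R G x\<close> is \<open>W (norm x) / norm x ^ N\<close>
  times \<open>x\<close>. As \<open>U\<close> stays between \<open>U 0\<close> and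
  \<open>U 1\<close>, the values \<open>g (U r)\<close> are bounded, whatever the growth of
  \<open>g\<close>. Nonconstancy comes from \<open>U 0 < U 1\<close>.\<close>

lemma good_solution_of_profile:
  fixes U W g :: "real \<Rightarrow> real"
  assumes p: "2 < p" and m: "DIM('a::euclidean_space) = Suc m" and g: "continuous_on {0..} g"
    and U_der: "\<And>r. r \<in> {0..1} \<Longrightarrow> (U has_real_derivative (W r / r ^ m) powr (1 / (p - 1))) (at r within {0..1})"
    and W_der: "\<And>r. r \<in> {0..1} \<Longrightarrow> (W has_real_derivative - (r ^ m * (g (U r) - U r powr (p - 1)))) (at r within {0..1})"
    and W_bd: "\<And>r. r \<in> {0..1} \<Longrightarrow> 0 \<le> W r \<and> W r \<le> C * r * r ^ m" and W1: "W 1 = 0"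
    and V: "continuous_on {0..1} (\<lambda>r. (W r / r ^ m) powr (1 / (p - 1)))"
    and U_mono: "mono_on {0..1} U" and U0: "0 < U 0" "U 0 < U 1"
  shows "good_solution p g (\<lambda>x::'a. U (norm x))" "continuous_on (ball 0 1) (\<lambda>x::'a. U (norm x))"
proof -
  let ?L = "lebesgue_on (ball (0::'a) 1)" and ?N = "DIM('a)"
  define V where "V r = (W r / r ^ m) powr (1 / (p - 1))" for r
  define u where "u x = U (norm x)" for x :: 'a
  define G where "G x = (V (norm x) / norm x) *\<^sub>R x" for x :: 'a
  interpret L: finite_measure ?L by (rule finite_measure_lebesgue_on) simp
  have bs: "ball (0::'a) 1 \<in> sets lebesgue" by simp
  have W0: "W 0 = 0" using W_bd[of 0] by simp
  have V0: "V 0 = 0" by (simp add: V_def W0)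
  have Vc: "continuous_on {0..1} V" using V by (simp add: V_def[abs_def])
  have V_nn: "0 \<le> V r" for r by (simp add: V_def)
  have Uc: "continuous_on {0..1} U" using U_der by (rule DERIV_continuous_on)
  have Wc: "continuous_on {0..1} W" using W_der by (rule DERIV_continuous_on)
  have C1: "\<And>x. x \<in> ball 0 1 \<Longrightarrow> (u has_derivative (\<lambda>h. G x \<bullet> h)) (at x)" "continuous_on (ball 0 1) G"
    unfolding u_def[abs_def] G_def[abs_def] using radial_C1[of U V] U_der Vc V0 by (auto simp: V_def)
  have uc: "continuous_on (ball 0 1) u"
    using C1(1) by (intro has_derivative_continuous_on) (auto intro: has_derivative_at_withinI)
  then show "continuous_on (ball 0 1) (\<lambda>x::'a. U (norm x))" by (simp add: u_def[abs_def])
  have U_pos: "0 < U r" "U r \<le> U 1" if "r \<in> {0..1}" for r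
    using mono_onD[OF U_mono, of 0 r] mono_onD[OF U_mono, of r 1] that U0 by auto
  have U_nn: "U ` {0..1} \<subseteq> {0..}" using U_pos by (auto intro: less_imp_le)
  have gU: "continuous_on {0..1} (\<lambda>r. g (U r))" by (rule continuous_on_compose2[OF g Uc U_nn])
  have pU: "continuous_on {0..1} (\<lambda>r. U r powr (p - 1))"
    using U_pos by (intro continuous_on_powr Uc continuous_on_const) force
  have bdd: "\<exists>B. \<forall>r\<in>{0..1}. \<bar>q r\<bar> \<le> B" if "continuous_on {0..1} q" for q :: "real \<Rightarrow> real"
  proof -
    have "bounded (q ` {0..1})" by (intro compact_imp_bounded compact_continuous_image that) auto
    then show ?thesis by (auto simp: bounded_iff)
  qed
  have mc: "(\<lambda>x. q (norm x)) \<in> borel_measurable ?L" if "continuous_on {0..1} q" for q :: "real \<Rightarrow> real"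
    by (rule continuous_imp_measurable_on_sets_lebesgue)
      (auto intro!: continuous_on_compose2[OF that] continuous_intros)
  have int_radial: "integrable ?L (\<lambda>x. q (norm x) * phi x)"
    if q: "continuous_on {0..1} q" and phi: "integrable ?L phi" for q and phi :: "'a \<Rightarrow> real"
  proof -
    obtain B where "\<forall>r\<in>{0..1}. \<bar>q r\<bar> \<le> B" using bdd[OF q] by blast
    then show ?thesis using integrable_bounded_mult[OF phi mc[OF q], of B] by simp
  qed
  have int_powr: "integrable ?L (\<lambda>x. \<bar>q (norm x)\<bar> powr p)" if q: "continuous_on {0..1} q" for q :: "real \<Rightarrow> real"
  proof -
    have "continuous_on {0..1} (\<lambda>r. \<bar>q r\<bar> powr p)"
      using p q by (intro continuous_on_powr') (auto intro!: continuous_intros)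
    from int_radial[OF this L.integrable_const[of 1]] show ?thesis by simp
  qed
  have normG: "norm (G x) = V (norm x)" for x
    using V_nn V0 by (cases "x = 0") (auto simp: G_def)
  have sob: "sobolev_grad p (ball 0 1) u G"
    unfolding sobolev_grad_def
  proof (intro conjI)
    show "weak_gradient (ball 0 1) u G" by (rule C1_imp_weak_gradient) (use C1 in auto)
    show "integrable ?L (\<lambda>x. \<bar>u x\<bar> powr p)" unfolding u_def by (rule int_powr[OF Uc])
    show "integrable ?L (\<lambda>x. norm (G x) powr p)"
      using int_powr[OF Vc] V_nn by (simp add: normG)
  qed
  have flux: "norm (G x) powr (p - 2) * (G x \<bullet> y) = W (norm x) / norm x ^ ?N * (x \<bullet> y)" if x: "x \<in> ball 0 1" for x y
  proof (cases "x = 0")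
    case False
    have q: "0 \<le> W (norm x)" using W_bd[of "norm x"] x by simp
    have "V (norm x) powr (p - 2) * V (norm x) = V (norm x) powr (p - 2) * V (norm x) powr 1"
      using V_nn[of "norm x"] by simp
    also have "\<dots> = V (norm x) powr (p - 1)" unfolding powr_add[symmetric] by simp
    also have "\<dots> = W (norm x) / norm x ^ m" using p q by (simp add: V_def powr_powr)
    finally have *: "V (norm x) powr (p - 2) * V (norm x) = W (norm x) / norm x ^ m" .
    have "norm (G x) powr (p - 2) * (G x \<bullet> y) = (V (norm x) powr (p - 2) * V (norm x)) / norm x * (x \<bullet> y)"
      unfolding normG by (simp add: G_def)
    also have "\<dots> = W (norm x) / norm x ^ ?N * (x \<bullet> y)" unfolding * by (simp add: m mult.commute)
    finally show ?thesis .
  qed (simp add: G_def)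
  have weak: "neumann_weak_solution p g (ball 0 1) u"
    unfolding neumann_weak_solution_def
  proof (intro conjI ballI exI[of _ G] allI impI)
    show "0 < u x" if "x \<in> ball 0 1" for x using that by (auto simp: u_def intro!: U_pos)
    show "sobolev_grad p (ball 0 1) u G" by (rule sob)
    fix phi :: "'a \<Rightarrow> real" and Phi :: "'a \<Rightarrow> 'a" assume s: "sobolev_grad p (ball 0 1) phi Phi"
    then have wg: "weak_gradient (ball 0 1) phi Phi" by (simp add: sobolev_grad_def)
    have ms: "phi \<in> borel_measurable ?L" "Phi \<in> borel_measurable ?L"
      using wg by (auto simp: weak_gradient_def)
    have phi: "integrable ?L phi"
      using integrable_of_integrable_powr[OF L.finite_measure_axioms ms(1), of p] s p by (simp add: sobolev_grad_def)
    have Phi: "integrable ?L Phi"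
      using integrable_of_integrable_powr[OF L.finite_measure_axioms ms(2), of p] s p by (simp add: sobolev_grad_def)
    have i1: "integrable ?L (\<lambda>x. g (u x) * phi x)" unfolding u_def by (rule int_radial[OF gU phi])
    then show "integrable ?L (\<lambda>x. g (u x) * phi x)" .
    have i2: "integrable ?L (\<lambda>x. u x powr (p - 1) * phi x)" unfolding u_def by (rule int_radial[OF pU phi])
    have i3: "integrable ?L (\<lambda>x. norm (G x) powr (p - 2) * (G x \<bullet> Phi x))"
    proof -
      have "continuous_on {0..1} (\<lambda>r. V r powr (p - 1))"
        using V_nn p by (intro continuous_on_powr' Vc continuous_on_const) auto
      then have "integrable ?L (\<lambda>x. V (norm x) powr (p - 1) * norm (Phi x))"
        using Phi by (intro int_radial) auto
      then show ?thesis
      proof (rule Bochner_Integration.integrable_bound)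
        have [measurable]: "G \<in> borel_measurable ?L" "Phi \<in> borel_measurable ?L"
          using C1(2) bs ms by (auto intro: continuous_imp_measurable_on_sets_lebesgue)
        show "(\<lambda>x. norm (G x) powr (p - 2) * (G x \<bullet> Phi x)) \<in> borel_measurable ?L" by measurable
        show "AE x in ?L. norm (norm (G x) powr (p - 2) * (G x \<bullet> Phi x)) \<le> norm (V (norm x) powr (p - 1) * norm (Phi x))"
        proof (rule AE_I2)
          fix x
          have "norm (norm (G x) powr (p - 2) * (G x \<bullet> Phi x)) \<le> norm (G x) powr (p - 2) * (norm (G x) * norm (Phi x))"
            using Cauchy_Schwarz_ineq2[of "G x" "Phi x"] by (simp add: abs_mult mult_left_mono)
          also have "\<dots> = (V (norm x) powr (p - 2) * V (norm x) powr 1) * norm (Phi x)"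
            using V_nn[of "norm x"] by (simp add: normG)
          also have "\<dots> = V (norm x) powr (p - 1) * norm (Phi x)" unfolding powr_add[symmetric] by simp
          finally show "norm (norm (G x) powr (p - 2) * (G x \<bullet> Phi x)) \<le> norm (V (norm x) powr (p - 1) * norm (Phi x))"
            by simp
        qed
      qed
    qed
    have "integral\<^sup>L ?L (\<lambda>x. norm (G x) powr (p - 2) * (G x \<bullet> Phi x))
        = integral\<^sup>L ?L (\<lambda>x. W (norm x) / norm x ^ ?N * (x \<bullet> Phi x))"
      by (intro Bochner_Integration.integral_cong refl flux) simp
    also have "\<dots> = integral\<^sup>L ?L (\<lambda>x. (g (U (norm x)) - U (norm x) powr (p - 1)) * phi x)"
    proof (rule flux_weak_form[OF wg phi Phi m _ _ Wc W1])
      show "(W has_real_derivative - (r ^ m * (g (U r) - U r powr (p - 1)))) (at r)" if r: "0 < r" "r < 1" for r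
        using W_der[of r] at_within_Icc_at[OF r] r by simp
      show "continuous_on {0..1} (\<lambda>r. g (U r) - U r powr (p - 1))" by (intro continuous_on_diff gU pU)
    qed (use W_bd in auto)
    also have "\<dots> = integral\<^sup>L ?L (\<lambda>x. g (u x) * phi x) - integral\<^sup>L ?L (\<lambda>x. u x powr (p - 1) * phi x)"
      unfolding Bochner_Integration.integral_diff[OF i1 i2, symmetric] by (simp add: u_def left_diff_distrib)
    finally show "integral\<^sup>L ?L (\<lambda>x. norm (G x) powr (p - 2) * (G x \<bullet> Phi x) + u x powr (p - 1) * phi x)
        = integral\<^sup>L ?L (\<lambda>x. g (u x) * phi x)"
      unfolding Bochner_Integration.integral_add[OF i3 i2] by simp
  qed
  have nonconst: "\<not> (AE x in ?L. u x = c)" for c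
  proof
    assume "AE x in ?L. u x = c"
    then have ae: "AE x in ?L. u x - c = 0" by simp
    have zero: "u x - c = 0" if "x \<in> ball 0 1" for x
      by (rule AE_zero_imp_zero[OF _ _ ae that]) (auto intro!: continuous_intros uc)
    have Ur: "U r = c" if r: "r \<in> {0..<1}" for r
    proof -
      obtain b :: 'a where "b \<in> Basis" using nonempty_Basis by blast
      then show ?thesis using zero[of "r *\<^sub>R b"] r by (simp add: u_def)
    qed
    \<comment> \<open>Constancy on the open ball extends to radius 1 by continuity of
      \<open>U\<close>.\<close>
    have "U 1 = c"
      by (rule continuous_constant_on_closure[of "{0..<1}" U]) (use Uc Ur in auto)
    with Ur[of 0] U0 show False by simp
  qed
  have "mono_on {0..<1} U" using U_mono by (rule mono_on_subset) auto
  with weak nonconst show "good_solution p g (\<lambda>x::'a. U (norm x))"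
    unfolding good_solution_def u_def[abs_def] by blast
qed

subsection \<open>Reduction to the shooting problem\<close>

text \<open>The last two properties locate the value at the origin: it lies below \<open>u0\<close>,
  but not below any smaller positive constant solution. They separate the solutions that belong to
  different \<open>u0\<close>.\<close>

lemma radial_solution_below:
  fixes p :: real and g g' :: "real \<Rightarrow> real" and u0 :: real
  assumes p: "p > 2"
    and deriv: "\<And>s. s \<ge> 0 \<Longrightarrow> (g has_real_derivative g' s) (at s within {0..})"
    and g1: "((\<lambda>s. g s / s powr (p - 1)) \<longlongrightarrow> L) (at_right 0)"
    and g2: "Liminf at_top (\<lambda>s. ereal (g s / s powr (p - 1))) > 1"
    and g3: "u0 > 0" "g u0 = u0 powr (p - 1)" "g' u0 > (p - 1) * u0 powr (p - 2)"
  shows "\<exists>u :: 'a::euclidean_space \<Rightarrow> real. good_solution p g u \<and> continuous_on (ball 0 1) u \<and> u 0 < u0 \<and>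
      (\<forall>z. 0 < z \<and> z < u0 \<and> g z = z powr (p - 1) \<longrightarrow> z \<le> u 0)"
proof -
  have g_cont: "continuous_on {0..} g" using deriv by (intro DERIV_continuous_on) auto
  \<comment> \<open>Reading \<open>s\<close> as \<open>max 0 s\<close> extends the nonlinearity to
    the line; together with \<open>g 0 = 0\<close> it is 0 on the negative half-line.\<close>
  define f where "f s = g (max 0 s) - max 0 s powr (p - 1)" for s
  have f_cont: "continuous_on UNIV f"
    unfolding f_def[abs_def] using p
    by (intro continuous_on_diff continuous_on_max_powr continuous_on_compose2[OF g_cont] continuous_intros) auto
  \<comment> \<open>\<open>g s\<close> is the quotient in \<open>g1\<close> times
    \<open>s powr (p - 1)\<close>, and the second factor tends to 0.\<close>
  have g0: "g 0 = 0"
  proof -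
    have c: "continuous_on UNIV (\<lambda>s::real. max 0 s powr (p - 1))"
      using p by (intro continuous_on_max_powr) simp
    from continuous_on_def[THEN iffD1, OF c, THEN bspec, OF UNIV_I, of 0]
    have "((\<lambda>s::real. max 0 s powr (p - 1)) \<longlongrightarrow> 0) (at 0)" by simp
    then have "((\<lambda>s::real. max 0 s powr (p - 1)) \<longlongrightarrow> 0) (at_right 0)"
      by (auto intro: filterlim_mono at_le)
    from tendsto_mult[OF g1 this]
    have "((\<lambda>s. g s / s powr (p - 1) * max 0 s powr (p - 1)) \<longlongrightarrow> 0) (at_right 0)" by simp
    moreover have "\<forall>\<^sub>F s in at_right 0. g s / s powr (p - 1) * max 0 s powr (p - 1) = g s"
      using eventually_at_right_less[of "0::real"] by eventually_elim simp
    ultimately have "(g \<longlongrightarrow> 0) (at_right 0)" by (rule Lim_transform_eventually)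
    moreover have "(g \<longlongrightarrow> g 0) (at_right 0)"
      using g_cont by (auto simp: continuous_on_def intro: tendsto_within_subset)
    ultimately show ?thesis using tendsto_unique[of "at_right (0::real)"] by force
  qed
  have f0: "f 0 = 0" by (simp add: f_def g0)
  have fu0: "f u0 = 0" using g3 by (simp add: f_def)
  obtain a \<delta> where a: "0 < a" and \<delta>: "0 < \<delta>" "\<delta> < u0"
    and slope: "\<And>s. \<bar>s - u0\<bar> \<le> \<delta> \<Longrightarrow> a * (s - u0)\<^sup>2 \<le> f s * (s - u0)"
  proof -
    define D where "D = g' u0 - (p - 1) * u0 powr (p - 2)"
    have D: "0 < D" using g3 by (simp add: D_def)
    have "at u0 within {0..} = at u0" using g3 by (intro at_within_interior) simp
    then have "(g has_real_derivative g' u0) (at u0)" using deriv[of u0] g3 by simp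
    then have "((\<lambda>s. g s - s powr (p - 1)) has_real_derivative D) (at u0)"
      using g3 p by (auto intro!: derivative_eq_intros simp: D_def)
    then have "(f has_real_derivative D) (at u0)"
      by (rule has_field_derivative_transform_within_open[of _ _ _ "{0<..}"]) (use g3 in \<open>auto simp: f_def\<close>)
    then have "((\<lambda>s. (f s - f u0) / (s - u0)) \<longlongrightarrow> D) (at u0)" by (simp add: has_field_derivative_iff)
    then have "\<forall>\<^sub>F s in at u0. D / 2 < f s / (s - u0)"
      using D fu0 by (intro order_tendstoD(1)[of _ D]) auto
    then obtain d where d: "0 < d" "\<And>s. s \<noteq> u0 \<Longrightarrow> \<bar>s - u0\<bar> < d \<Longrightarrow> D / 2 < f s / (s - u0)"
      by (auto simp: eventually_at dist_real_def)
    \<comment> \<open>Half the slope at \<open>u0\<close> absorbs the error of the difference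
      quotient; the halved radii put the closed neighbourhood inside the open one and make
      \<open>\<delta> < u0\<close>.\<close>
    show thesis
    proof (rule that[of "D / 2" "min (d / 2) (u0 / 2)"])
      fix s assume s: "\<bar>s - u0\<bar> \<le> min (d / 2) (u0 / 2)"
      show "D / 2 * (s - u0)\<^sup>2 \<le> f s * (s - u0)"
      proof (cases "s = u0")
        case False
        then have "D / 2 < f s / (s - u0)" using d s by auto
        then have "D / 2 * (s - u0)\<^sup>2 \<le> f s / (s - u0) * (s - u0)\<^sup>2" by (intro mult_right_mono) auto
        then show ?thesis using False by (simp add: power2_eq_square)
      qed simp
    qed (use D d g3 in auto)
  qed
  have near: "f s < 0" if "u0 - \<delta> \<le> s" "s < u0" for s
  proof -
    have "0 < a * (s - u0)\<^sup>2" using a that by simp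
    also have "\<dots> \<le> f s * (s - u0)" using that by (intro slope) auto
    finally show ?thesis using that by (simp add: zero_less_mult_iff)
  qed
  \<comment> \<open>The zeros of \<open>f\<close> in \<open>{0..u0 - \<delta>}\<close> form a
    compact set containing 0. Its largest element serves as \<open>lo\<close>, since
    \<open>f\<close> is negative from \<open>u0 - \<delta>\<close> up to \<open>u0\<close>.\<close>
  define Z where "Z = {0..u0 - \<delta>} \<inter> f -` {0}"
  have Zc: "compact Z"
  proof -
    have "closed Z" unfolding Z_def by (intro continuous_closed_preimage continuous_on_subset[OF f_cont]) auto
    moreover have "bounded Z" by (rule bounded_subset[of "{0..u0 - \<delta>}"]) (auto simp: Z_def)
    ultimately show ?thesis by (simp add: compact_eq_bounded_closed)
  qed
  have "0 \<in> Z" using f0 \<delta> by (simp add: Z_def)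
  then obtain lo where lo: "lo \<in> Z" "\<And>z. z \<in> Z \<Longrightarrow> z \<le> lo"
    using compact_attains_sup[OF Zc] by blast
  have f_neg: "f s < 0" if s: "lo < s" "s < u0" for s
  proof (rule ccontr)
    assume "\<not> f s < 0"
    then have pos: "0 \<le> f s" by simp
    then have s': "s < u0 - \<delta>" using near[of s] s by (cases "u0 - \<delta> \<le> s") auto
    obtain z where z: "s \<le> z" "z \<le> u0 - \<delta>" "f z = 0"
      using IVT2'[of f "u0 - \<delta>" 0 s] near[of "u0 - \<delta>"] \<delta> pos s' continuous_on_subset[OF f_cont] by auto
    then have "z \<in> Z" using s lo(1) by (simp add: Z_def)
    with lo(2)[of z] z s show False by simp
  qed
  \<comment> \<open>By \<open>g2\<close> the nonlinearity is nonnegative far out; on the remaining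
    compact interval it is bounded, and it is 0 on the negative half-line.\<close>
  obtain C where C: "0 < C" "\<And>s. - C \<le> f s"
  proof -
    have "\<forall>\<^sub>F s in at_top. 1 < ereal (g s / s powr (p - 1))" by (rule less_LiminfD[OF g2])
    then obtain M where M: "\<And>s. M \<le> s \<Longrightarrow> 1 < g s / s powr (p - 1)"
      by (auto simp: eventually_at_top_linorder one_ereal_def)
    define M' where "M' = max M 1"
    have far: "0 \<le> f s" if "M' \<le> s" for s
    proof -
      have "1 < g s / s powr (p - 1)" "0 < s" using M[of s] that by (auto simp: M'_def)
      then show ?thesis by (simp add: f_def field_simps)
    qed
    have "bounded (f ` {0..M'})"
      by (intro compact_imp_bounded compact_continuous_image continuous_on_subset[OF f_cont]) auto
    then obtain B where B: "\<forall>y\<in>f ` {0..M'}. norm y \<le> B" unfolding bounded_iff by blast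
    have "- max 1 B \<le> f s" for s
    proof -
      consider "s < 0" | "0 \<le> s" "s \<le> M'" | "M' \<le> s" by linarith
      then show ?thesis
      proof cases
        case 1
        then have "f s = 0" by (simp add: f_def g0)
        then show ?thesis by simp
      next
        case 2
        then have "\<bar>f s\<bar> \<le> B" using B by auto
        then show ?thesis by linarith
      next
        case 3
        then show ?thesis using far[of s] by linarith
      qed
    qed
    then show thesis using that[of "max 1 B"] by simp
  qed
  have f_hom: "\<exists>K>0. \<forall>s\<in>{0..u0}. - f s \<le> K * s powr (1 / (1 / (p - 1)))"
  proof -
    have "\<forall>\<^sub>F s in at_right 0. L - 1 < g s / s powr (p - 1)"
      using g1 by (intro order_tendstoD(1)) auto
    then obtain \<eta> where \<eta>: "0 < \<eta>" "\<And>s. 0 < s \<Longrightarrow> s < \<eta> \<Longrightarrow> L - 1 < g s / s powr (p - 1)"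
      unfolding eventually_at_right_field by auto
    \<comment> \<open>Near 0 the quotient in \<open>g1\<close> exceeds \<open>L - 1\<close>, so the
      factor \<open>2 - L\<close> suffices and the first two terms dominate it; for
      \<open>s \<ge> \<eta>\<close> the bound \<open>- f s \<le> C\<close> is absorbed by the last
      term.\<close>
    define K where "K = \<bar>L\<bar> + 2 + C / \<eta> powr (p - 1)"
    have Kpos: "0 \<le> C / \<eta> powr (p - 1)" using C by simp
    have "- f s \<le> K * s powr (p - 1)" if s: "0 \<le> s" for s
    proof -
      consider "s = 0" | "0 < s" "s < \<eta>" | "\<eta> \<le> s" using s by linarith
      then show ?thesis
      proof cases
        case 1
        then show ?thesis using f0 by simp
      next
        case 2
        then have "(L - 1) * s powr (p - 1) < g s" using \<eta>(2)[of s] by (simp add: field_simps)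
        then have "- f s \<le> (2 - L) * s powr (p - 1)" using 2 by (simp add: f_def algebra_simps)
        also have "\<dots> \<le> K * s powr (p - 1)" using Kpos by (intro mult_right_mono) (auto simp: K_def)
        finally show ?thesis .
      next
        case 3
        have "- f s \<le> C" using C(2)[of s] by simp
        also have "\<dots> = C / \<eta> powr (p - 1) * \<eta> powr (p - 1)" using \<eta> by simp
        also have "\<dots> \<le> K * s powr (p - 1)"
          using Kpos 3 \<eta> p by (intro mult_mono powr_mono2) (auto simp: K_def)
        finally show ?thesis .
      qed
    qed
    moreover have "0 < K" using Kpos by (simp add: K_def)
    ultimately show ?thesis by (intro exI[of _ K]) auto
  qed
  define m where "m = DIM('a) - 1"
  have m: "DIM('a) = Suc m" using DIM_positive[where 'a = 'a] by (simp add: m_def)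
  interpret euler_shooting f "1 / (p - 1)" m lo u0 C
  proof
    show "0 < 1 / (p - 1)" "1 / (p - 1) < 1" using p by auto
    show "0 \<le> lo" "lo < u0" "f lo = 0" using lo(1) \<delta> by (auto simp: Z_def)
    show "\<exists>a>0. \<exists>\<delta>>0. \<forall>s. \<bar>s - u0\<bar> \<le> \<delta> \<longrightarrow> a * (s - u0)\<^sup>2 \<le> f s * (s - u0)"
      using a \<delta>(1) slope by blast
  qed (use f_cont fu0 f_neg C f_hom in auto)
  obtain U W where UW:
    "\<forall>r\<in>{0..1}. (U has_real_derivative psi (W r / r ^ m)) (at r within {0..1})"
    "\<forall>r\<in>{0..1}. (W has_real_derivative - (r ^ m * f (U r))) (at r within {0..1})"
    "\<forall>r\<in>{0..1}. 0 \<le> W r \<and> W r \<le> C * r * r ^ m" "W 1 = 0"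
    "continuous_on {0..1} (\<lambda>r. psi (W r / r ^ m))" "mono_on {0..1} U" "lo \<le> U 0" "0 < U 0" "U 0 < u0" "u0 \<le> U 1"
    using profile_exists by blast
  have psi_eq: "psi (W r / r ^ m) = (W r / r ^ m) powr (1 / (p - 1))" if "r \<in> {0..1}" for r
    using UW(3) that by (simp add: psi_def)
  have V_cont: "continuous_on {0..1} (\<lambda>r. (W r / r ^ m) powr (1 / (p - 1)))"
    using UW(5) by (rule continuous_on_eq) (rule psi_eq)
  have U_pos: "0 < U r" if "r \<in> {0..1}" for r
    using mono_onD[OF UW(6), of 0 r] that UW(8) by auto
  have sol: "good_solution p g (\<lambda>x::'a. U (norm x))" "continuous_on (ball 0 1) (\<lambda>x::'a. U (norm x))"
    using UW psi_eq U_pos V_cont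
    by (atomize (full), intro conjI good_solution_of_profile[OF p m g_cont, of U W C])
      (auto simp: f_def less_imp_le)
  have below: "z \<le> U 0" if z: "0 < z" "z < u0" "g z = z powr (p - 1)" for z
  proof -
    have "f z = 0" using z by (simp add: f_def)
    then have "z \<le> lo" using f_neg[of z] z by (cases "lo < z") auto
    with UW(7) show ?thesis by simp
  qed
  show ?thesis using sol below UW(9) by (intro exI[of _ "\<lambda>x::'a. U (norm x)"]) auto
qed

section \<open>Existence, and multiplicity from separated values at the origin\<close>

theorem theorem1p1:
  fixes p :: real and g g' :: "real \<Rightarrow> real" and u0 :: real
  assumes p: "p > 2"
    and C1: "continuous_on {0..} g'"
    and deriv: "\<And>s. s \<ge> 0 \<Longrightarrow> (g has_real_derivative g' s) (at s within {0..})"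
    and g1: "\<exists>L. ((\<lambda>s. g s / s powr (p - 1)) \<longlongrightarrow> L) (at_right 0) \<and> 0 \<le> L \<and> L < 1"
    and g2: "Liminf at_top (\<lambda>s. ereal (g s / s powr (p - 1))) > 1"
    and g3: "u0 > 0" "g u0 = u0 powr (p - 1)" "g' u0 > (p - 1) * u0 powr (p - 2)"
  shows "(\<exists>u :: 'a::euclidean_space \<Rightarrow> real. good_solution p g u) \<and>
         (\<forall>(n::nat) (U::nat \<Rightarrow> real).
            inj_on U {..<n} \<and>
            (\<forall>i<n. U i > 0 \<and> g (U i) = U i powr (p - 1) \<and> g' (U i) > (p - 1) * U i powr (p - 2))
            \<longrightarrow> (\<exists>us :: nat \<Rightarrow> 'a \<Rightarrow> real.
                   (\<forall>i<n. good_solution p g (us i)) \<and>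
                   (\<forall>i<n. \<forall>j<n. i \<noteq> j \<longrightarrow>
                      \<not> (AE x in lebesgue_on (ball 0 1). us i x = us j x))))"
proof -
  obtain L where L: "((\<lambda>s. g s / s powr (p - 1)) \<longlongrightarrow> L) (at_right 0)" using g1 by blast
  note sol = radial_solution_below[OF p deriv L g2]
  have "\<exists>u :: 'a \<Rightarrow> real. good_solution p g u" using sol[OF _ g3] by blast
  moreover have "\<exists>us :: nat \<Rightarrow> 'a \<Rightarrow> real. (\<forall>i<n. good_solution p g (us i)) \<and>
      (\<forall>i<n. \<forall>j<n. i \<noteq> j \<longrightarrow> \<not> (AE x in lebesgue_on (ball 0 1). us i x = us j x))"
    if inj: "inj_on U {..<n}"
      and U: "\<forall>i<n. U i > 0 \<and> g (U i) = U i powr (p - 1) \<and> g' (U i) > (p - 1) * U i powr (p - 2)"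
    for n and U :: "nat \<Rightarrow> real"
  proof -
    have "\<forall>i\<in>{..<n}. \<exists>u :: 'a \<Rightarrow> real. good_solution p g u \<and> continuous_on (ball 0 1) u \<and> u 0 < U i \<and>
        (\<forall>z. 0 < z \<and> z < U i \<and> g z = z powr (p - 1) \<longrightarrow> z \<le> u 0)"
    proof
      fix i assume "i \<in> {..<n}"
      then show "\<exists>u :: 'a \<Rightarrow> real. good_solution p g u \<and> continuous_on (ball 0 1) u \<and> u 0 < U i \<and>
          (\<forall>z. 0 < z \<and> z < U i \<and> g z = z powr (p - 1) \<longrightarrow> z \<le> u 0)"
        using U by (intro sol) auto
    qed
    then obtain us :: "nat \<Rightarrow> 'a \<Rightarrow> real" where us: "\<forall>i\<in>{..<n}. good_solution p g (us i) \<and>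
        continuous_on (ball 0 1) (us i) \<and> us i 0 < U i \<and>
        (\<forall>z. 0 < z \<and> z < U i \<and> g z = z powr (p - 1) \<longrightarrow> z \<le> us i 0)"
      by (auto dest!: bchoice)
    \<comment> \<open>If \<open>U i < U j\<close>, then \<open>U i\<close> is itself a constant
      solution below \<open>U j\<close>, so \<open>us i 0 < U i \<le> us j 0\<close>.\<close>
    have less: "us i 0 < us j 0" if "i < n" "j < n" "U i < U j" for i j
      using us U that by (meson lessThan_iff less_le_trans)
    have "\<not> (AE x in lebesgue_on (ball 0 1). us i x = us j x)" if ij: "i < n" "j < n" "i \<noteq> j" for i j
    proof
      assume "AE x in lebesgue_on (ball 0 1). us i x = us j x"
      then have ae: "AE x in lebesgue_on (ball 0 1). us i x - us j x = 0" by simp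
      have "us i 0 - us j 0 = 0"
        by (rule AE_zero_imp_zero[OF _ _ ae]) (use us ij in \<open>auto intro!: continuous_on_diff\<close>)
      moreover have "U i \<noteq> U j" using inj ij by (auto dest: inj_onD)
      ultimately show False using less[of i j] less[of j i] ij by (cases "U i < U j") auto
    qed
    then show ?thesis using us by (intro exI[of _ us]) auto
  qed
  ultimately show ?thesis by blast
qed

end
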